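(* If $A\subseteq\omega$ is weakly 1-generic, then $A$ is quasiminimal in the cofinite degrees, and hence also in the mod-finite degrees, in the (uniform) generic degrees, and in the (uniform) coarse degrees.
   Context: A real is a subset of $\omega$, identified with its characteristic function. A real $X$ is density-1 if $\lim_{n\to\infty}|X\cap n|/n=1$. A real is weakly 1-generic if it meets (has an initial segment in) every dense $\Sigma^0_1$ set of strings $S\subseteq2^{<\omega}$. A (time-dependent) partial oracle $(A)$ for a real $A$ is a set of triples $\langle n,x,l\rangle$ with $n,l\in\omega$, $x\in\{0,1\}$, such that $\langle n,x,l\rangle\in(A)$ implies $A(n)=x$, and for every $n,x$ there is at most one $l$ with $\langle n,x,l\rangle\in(A)$. Its domain is the set of $n$ for which some $\langle n,x,l\rangle\in(A)$ exists. A Turing functional uses $(A)$ as an ordinary oracle for this set of triples. A generic (respectively cofinite) oracle for $A$ is a partial oracle for $A$ with density-1 (respectively cofinite) domain. A partial computation of $B$ is a (possibly oracle) computation $\psi$ with $\psi(n)=B(n)$ whenever $\psi(n)\downarrow$. Reducibilities between reals (all uniform: one Turing functional $\phi$ must work for all listed oracles): - $B\leq_{\mathrm{g}}A$ (generic): there is $\phi$ such that for every generic oracle $(A)$ for $A$, $\phi^{(A)}$ is a partial computation of $B$ with density-1 domain. - $B\leq_{\mathrm{c}}A$ (coarse): there is $\phi$ such that for every $C$ with $\{n:A(n)=C(n)\}$ density-1, $\phi^C$ is total, $\{0,1\}$-valued, and agrees with $B$ on a density-1 set. - $B\leq_{\mathrm{cf}}A$ (cofinite): there is $\phi$ such that for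 every cofinite oracle $(A)$ for $A$, $\phi^{(A)}$ is a partial computation of $B$ with cofinite domain. - $B\leq_{\mathrm{mf}}A$ (mod-finite): there is $\phi$ such that for every $C$ differing from $A$ at only finitely many places, $\phi^C$ is total and computes a set differing from $B$ at only finitely many places. For $X\subseteq\omega$ let $\mathcal{R}(X)=\{(2m+1)2^n:m\in\omega,\ n\in X\}$ and $\widetilde{\mathcal{R}}(X)=\{m:(\exists n\in X)(2^n\leq m<2^{n+1})\}$. For $\leq$ one of these reducibilities, a real $A$ is quasiminimal in the $\leq$ degrees if $A\nleq 0$ (where $0$ is the degree of the computable reals) and for every noncomputable $B$: $\widetilde{\mathcal{R}}(\mathcal{R}(B))\nleq A$ if $\leq$ is $\leq_{\mathrm{c}}$ or $\leq_{\mathrm{g}}$; $\mathcal{R}(B)\nleq A$ if $\leq$ is $\leq_{\mathrm{mf}}$ or $\leq_{\mathrm{cf}}$. *)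

theory Defs
  imports Complex_Main "HOL-Library.Nat_Bijection" "HOL-Library.Sublist"
begin

section \<open>Turing functionals\<close>

text \<open>
  A Turing functional is presented by a program built from Kleene's schemes for the partial
  recursive functions (composition, primitive recursion, unbounded search) together with a query to
  the characteristic function of an oracle. A program acts on argument lists; applying a
  basic function to a list of the wrong shape diverges.
\<close>

datatype functional =
    Zero
  | Succ
  | Proj nat
  | Query
  | Comp functional "functional list"
  | PrimRec functional functional
  | Mu functional

definition chi :: "nat set \<Rightarrow> nat \<Rightarrow> nat" where
  "chi X n = (if n \<in> X then 1 else 0)"

text \<open>In \<open>eval X p xs y\<close>, the program \<open>p\<close> with oracle \<open>X\<close> halts on the arguments \<open>xs\<close> with value \<open>y\<close>.\<close>

inductive eval :: "nat set \<Rightarrow> functional \<Rightarrow> nat list \<Rightarrow> nat \<Rightarrow> bool" for X :: "nat set" where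
  eval_Zero: "eval X Zero xs 0"
| eval_Succ: "eval X Succ [x] (Suc x)"
| eval_Proj: "i < length xs \<Longrightarrow> eval X (Proj i) xs (xs ! i)"
| eval_Query: "eval X Query [x] (chi X x)"
| eval_Comp: "length ys = length gs \<Longrightarrow> (\<forall>i<length gs. eval X (gs ! i) xs (ys ! i)) \<Longrightarrow>
    eval X f ys z \<Longrightarrow> eval X (Comp f gs) xs z"
| eval_PrimRec_0: "eval X f xs z \<Longrightarrow> eval X (PrimRec f g) (0 # xs) z"
| eval_PrimRec_Suc: "eval X (PrimRec f g) (k # xs) r \<Longrightarrow> eval X g (k # r # xs) z \<Longrightarrow>
    eval X (PrimRec f g) (Suc k # xs) z"
| eval_Mu: "eval X f (k # xs) 0 \<Longrightarrow> (\<forall>m<k. \<exists>y. eval X f (m # xs) (Suc y)) \<Longrightarrow>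
    eval X (Mu f) xs k"

lemma eval_deterministic:
  "eval X p xs y \<Longrightarrow> eval X p xs y' \<Longrightarrow> y = y'"
proof (induction arbitrary: y' rule: eval.induct)
  case (eval_Comp ys gs xs f z)
  from eval_Comp.prems obtain ys' where ys': "length ys' = length gs"
    "\<forall>i<length gs. eval X (gs ! i) xs (ys' ! i)" "eval X f ys' y'"
    by (auto elim: eval.cases)
  have "ys = ys'"
    using eval_Comp.hyps(1) eval_Comp.IH(1) ys'(1,2) by (auto intro: nth_equalityI)
  then show ?case using eval_Comp.IH(2) ys'(3) by blast
next
  case (eval_PrimRec_0 f xs z g)
  from eval_PrimRec_0.prems show ?case
    by (rule eval.cases) (auto intro: eval_PrimRec_0.IH)
next
  case (eval_PrimRec_Suc f g k xs r z)
  from eval_PrimRec_Suc.prems obtain r' where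
    "eval X (PrimRec f g) (k # xs) r'" "eval X g (k # r' # xs) y'"
    by (auto elim: eval.cases)
  then show ?case using eval_PrimRec_Suc.IH by blast
next
  case (eval_Mu f k xs)
  from eval_Mu.prems have 1: "eval X f (y' # xs) 0" "\<forall>m<y'. \<exists>y. eval X f (m # xs) (Suc y)"
    by (auto elim: eval.cases)
  show ?case
  proof (cases k y' rule: linorder_cases)
    case less
    then show ?thesis using eval_Mu.IH(1) 1(2) by (metis nat.distinct(1))
  next
    case greater
    then show ?thesis using eval_Mu.IH(2) 1(1) by (metis nat.distinct(1))
  qed
qed (erule eval.cases; simp)+

definition run :: "functional \<Rightarrow> nat set \<Rightarrow> nat \<Rightarrow> nat option" where
  "run p X n = (if \<exists>y. eval X p [n] y then Some (THE y. eval X p [n] y) else None)"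

lemma run_eq_Some_iff: "run p X n = Some y \<longleftrightarrow> eval X p [n] y"
proof
  assume "eval X p [n] y"
  moreover from this have "(THE y. eval X p [n] y) = y"
    using eval_deterministic by blast
  ultimately show "run p X n = Some y" by (auto simp: run_def)
next
  assume run: "run p X n = Some y"
  then obtain z where z: "eval X p [n] z" by (auto simp: run_def split: if_splits)
  then have "(THE y. eval X p [n] y) = z"
    using eval_deterministic by blast
  with run z show "eval X p [n] y" by (auto simp: run_def split: if_splits)
qed

definition computable :: "nat set \<Rightarrow> bool" where
  "computable X \<longleftrightarrow> (\<exists>p. \<forall>n. run p {} n = Some (chi X n))"

definition ce :: "nat set \<Rightarrow> bool" where
  "ce W \<longleftrightarrow> (\<exists>p. W = dom (run p {}))"


section \<open>Density and weak genericity\<close>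

definition density_1 :: "nat set \<Rightarrow> bool" where
  "density_1 X \<longleftrightarrow> (\<lambda>n. real (card (X \<inter> {..<n})) / real n) \<longlonglongrightarrow> 1"

definition string_code :: "bool list \<Rightarrow> nat" where
  "string_code s = list_encode (map of_bool s)"

definition Sigma01 :: "bool list set \<Rightarrow> bool" where
  "Sigma01 S \<longleftrightarrow> ce (string_code ` S)"

definition dense_strings :: "bool list set \<Rightarrow> bool" where
  "dense_strings S \<longleftrightarrow> (\<forall>s. \<exists>t\<in>S. prefix s t)"

definition initial_segment :: "nat set \<Rightarrow> nat \<Rightarrow> bool list" where
  "initial_segment A n = map (\<lambda>i. i \<in> A) [0..<n]"

definition weakly_1_generic :: "nat set \<Rightarrow> bool" where
  "weakly_1_generic A \<longleftrightarrow>
    (\<forall>S. Sigma01 S \<and> dense_strings S \<longrightarrow> (\<exists>n. initial_segment A n \<in> S))"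


section \<open>Partial oracles\<close>

type_synonym triples = "(nat \<times> nat \<times> nat) set"

definition partial_oracle :: "nat set \<Rightarrow> triples \<Rightarrow> bool" where
  "partial_oracle A P \<longleftrightarrow>
    (\<forall>n x l. (n, x, l) \<in> P \<longrightarrow> chi A n = x) \<and>
    (\<forall>n x. \<exists>\<^sub>\<le>\<^sub>1 l. (n, x, l) \<in> P)"

definition oracle_dom :: "triples \<Rightarrow> nat set" where
  "oracle_dom P = {n. \<exists>x l. (n, x, l) \<in> P}"

definition generic_oracle :: "nat set \<Rightarrow> triples \<Rightarrow> bool" where
  "generic_oracle A P \<longleftrightarrow> partial_oracle A P \<and> density_1 (oracle_dom P)"

definition cofinite_oracle :: "nat set \<Rightarrow> triples \<Rightarrow> bool" where
  "cofinite_oracle A P \<longleftrightarrow> partial_oracle A P \<and> finite (- oracle_dom P)"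

definition code_triples :: "triples \<Rightarrow> nat set" where
  "code_triples P = (\<lambda>(n, x, l). prod_encode (n, prod_encode (x, l))) ` P"

definition partial_computation :: "nat set \<Rightarrow> (nat \<Rightarrow> nat option) \<Rightarrow> bool" where
  "partial_computation B \<psi> \<longleftrightarrow> (\<forall>n\<in>dom \<psi>. \<psi> n = Some (chi B n))"


section \<open>Uniform reducibilities\<close>

definition generic_reducible :: "nat set \<Rightarrow> nat set \<Rightarrow> bool"  (infix "\<le>\<^sub>g" 50) where
  "B \<le>\<^sub>g A \<longleftrightarrow> (\<exists>p. \<forall>P. generic_oracle A P \<longrightarrow>
    partial_computation B (run p (code_triples P)) \<and> density_1 (dom (run p (code_triples P))))"

definition coarse_reducible :: "nat set \<Rightarrow> nat set \<Rightarrow> bool"  (infix "\<le>\<^sub>c" 50) where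
  "B \<le>\<^sub>c A \<longleftrightarrow> (\<exists>p. \<forall>C. density_1 {n. chi A n = chi C n} \<longrightarrow>
    (\<exists>D. (\<forall>n. run p C n = Some (chi D n)) \<and> density_1 {n. chi D n = chi B n}))"

definition cofinite_reducible :: "nat set \<Rightarrow> nat set \<Rightarrow> bool"  (infix "\<le>\<^sub>c\<^sub>f" 50) where
  "B \<le>\<^sub>c\<^sub>f A \<longleftrightarrow> (\<exists>p. \<forall>P. cofinite_oracle A P \<longrightarrow>
    partial_computation B (run p (code_triples P)) \<and> finite (- dom (run p (code_triples P))))"

definition mod_finite_reducible :: "nat set \<Rightarrow> nat set \<Rightarrow> bool"  (infix "\<le>\<^sub>m\<^sub>f" 50) where
  "B \<le>\<^sub>m\<^sub>f A \<longleftrightarrow> (\<exists>p. \<forall>C. finite {n. chi A n \<noteq> chi C n} \<longrightarrow>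
    (\<exists>D. (\<forall>n. run p C n = Some (chi D n)) \<and> finite {n. chi D n \<noteq> chi B n}))"


section \<open>Quasiminimality\<close>

definition cal_R :: "nat set \<Rightarrow> nat set" where
  "cal_R X = {(2 * m + 1) * 2 ^ n | m n. n \<in> X}"

definition cal_R_tilde :: "nat set \<Rightarrow> nat set" where
  "cal_R_tilde X = {m. \<exists>n\<in>X. 2 ^ n \<le> m \<and> m < 2 ^ (n + 1)}"

text \<open>
  The computable reals form a single degree, the least one, so the first clause may quantify over
  all of its representatives. The parameter \<open>e\<close> is the map inducing the embedding of the Turing degrees into the degrees of \<open>le\<close>.
\<close>

definition quasiminimal ::
    "(nat set \<Rightarrow> nat set \<Rightarrow> bool) \<Rightarrow> (nat set \<Rightarrow> nat set) \<Rightarrow> nat set \<Rightarrow> bool" where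
  "quasiminimal le e A \<longleftrightarrow>
    (\<forall>Z. computable Z \<longrightarrow> \<not> le A Z) \<and> (\<forall>B. \<not> computable B \<longrightarrow> \<not> le (e B) A)"

definition quasiminimal_cofinite :: "nat set \<Rightarrow> bool" where
  "quasiminimal_cofinite = quasiminimal (\<le>\<^sub>c\<^sub>f) cal_R"

definition quasiminimal_mod_finite :: "nat set \<Rightarrow> bool" where
  "quasiminimal_mod_finite = quasiminimal (\<le>\<^sub>m\<^sub>f) cal_R"

definition quasiminimal_generic :: "nat set \<Rightarrow> bool" where
  "quasiminimal_generic = quasiminimal (\<le>\<^sub>g) (\<lambda>B. cal_R_tilde (cal_R B))"

definition quasiminimal_coarse :: "nat set \<Rightarrow> bool" where
  "quasiminimal_coarse = quasiminimal (\<le>\<^sub>c) (\<lambda>B. cal_R_tilde (cal_R B))"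

end

theory Submission
  imports Defs
begin

text \<open>
  Suppose that \<open>A\<close> is weakly 1-generic and that a functional computes (a robust coding of) \<open>B\<close> from
  every oracle of the required kind for \<open>A\<close>. The strings from which the functional derives two
  different answers for the same bit of \<open>B\<close> form a \<open>\<Sigma>\<^sup>0\<^sub>1\<close> set that \<open>A\<close> does not meet, so some string
  \<open>s0\<close> has no extension in it. To decide whether \<open>n \<in> B\<close>, search for an extension \<open>t\<close> of \<open>s0\<close> that
  yields an answer about \<open>n\<close>. This answer is correct: the continuation of \<open>t\<close> by \<open>A\<close> differs from \<open>A\<close>
  finitely, hence also yields the right answer, and above \<open>s0\<close> there are no conflicts.

  For all four reducibilities an answer about \<open>n\<close> is a majority of equal values on the block that codes
  a place \<open>(2 * m + 1) * 2 ^ n\<close>: the place itself for \<open>cal_R\<close>, a dyadic interval for its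
  composition with the second coding. Likewise, the strings that disagree with a given partial
  computable function on a whole block beyond \<open>N\<close> are \<open>\<Sigma>\<^sup>0\<^sub>1\<close> and dense, hence \<open>A\<close> does not
  reduce to a computable real.
\<close>

section \<open>Closure properties of recursive functions\<close>

text \<open>Arity is part of the notion because programs act on argument lists. Writing all
  arguments as one list \<open>xs\<close> lets the closure rules apply directly to terms in
  \<open>xs\<close>.\<close>

definition recursive :: "nat \<Rightarrow> (nat list \<Rightarrow> nat) \<Rightarrow> bool" where
  "recursive n f \<longleftrightarrow> (\<exists>p. \<forall>xs. length xs = n \<longrightarrow> eval {} p xs (f xs))"

definition recursive_list :: "nat \<Rightarrow> nat \<Rightarrow> (nat list \<Rightarrow> nat list) \<Rightarrow> bool" where
  "recursive_list n m h \<longleftrightarrow> (\<forall>xs. length xs = n \<longrightarrow> length (h xs) = m) \<and>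
    (\<forall>j<m. recursive n (\<lambda>xs. h xs ! j))"

lemma recursive_cong:
  "recursive n f \<Longrightarrow> (\<And>xs. length xs = n \<Longrightarrow> f xs = g xs) \<Longrightarrow> recursive n g"
  by (auto simp: recursive_def)

lemma recursive_nth: "i < n \<Longrightarrow> recursive n (\<lambda>xs. xs ! i)"
  unfolding recursive_def by (rule exI[of _ "Proj i"]) (auto intro: eval_Proj)

lemma recursive_comp:
  assumes "recursive m f" "recursive_list n m h"
  shows "recursive n (\<lambda>xs. f (h xs))"
proof -
  obtain p where p: "\<And>xs. length xs = m \<Longrightarrow> eval {} p xs (f xs)"
    using assms(1) by (auto simp: recursive_def)
  have "\<forall>j<m. \<exists>q. \<forall>xs. length xs = n \<longrightarrow> eval {} q xs (h xs ! j)"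
    using assms(2) by (auto simp: recursive_list_def recursive_def)
  then obtain q where q: "\<And>j xs. j < m \<Longrightarrow> length xs = n \<Longrightarrow> eval {} (q j) xs (h xs ! j)"
    by metis
  have "eval {} (Comp p (map q [0..<m])) xs (f (h xs))" if "length xs = n" for xs
    using assms(2) that by (intro eval_Comp[where ys = "h xs"])
      (auto simp: recursive_list_def intro: p q)
  then show ?thesis by (auto simp: recursive_def)
qed

lemma recursive_list_Nil: "recursive_list n 0 (\<lambda>_. [])"
  by (simp add: recursive_list_def)

lemma recursive_list_Cons:
  "recursive n f \<Longrightarrow> recursive_list n m h \<Longrightarrow> recursive_list n (Suc m) (\<lambda>xs. f xs # h xs)"
  by (auto simp: recursive_list_def less_Suc_eq_0_disj)

lemma recursive_list_drop: "recursive_list (k + m) m (drop k)"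
  unfolding recursive_list_def
proof (intro conjI allI impI)
  fix j assume "j < m"
  then show "recursive (k + m) (\<lambda>xs. drop k xs ! j)"
    by (intro recursive_cong[OF recursive_nth[of "k + j"]]) auto
qed simp

lemma recursive_list_id: "recursive_list n n (\<lambda>xs. xs)"
  by (simp add: recursive_list_def recursive_nth)

lemma recursive_list_tl: "recursive_list (Suc n) n tl"
  using recursive_list_drop[of 1 n] by (simp add: drop_Suc[abs_def])

lemma recursive_list_map:
  "(\<And>g. g \<in> set gs \<Longrightarrow> recursive n (F g)) \<Longrightarrow>
    recursive_list n (length gs) (\<lambda>xs. map (\<lambda>g. F g xs) gs)"
  by (induction gs) (auto intro: recursive_list_Nil recursive_list_Cons)

lemmas recursive_comp1 =
  recursive_comp[OF _ recursive_list_Cons[OF _ recursive_list_Nil]]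
lemmas recursive_comp2 =
  recursive_comp[OF _ recursive_list_Cons[OF _ recursive_list_Cons[OF _ recursive_list_Nil]]]

section \<open>Arithmetic and decidable predicates\<close>

lemma recursive_Suc:
  assumes "recursive n f"
  shows "recursive n (\<lambda>xs. Suc (f xs))"
proof -
  have "eval {} Succ xs (Suc (hd xs))" if "length xs = 1" for xs
    using that by (cases xs) (auto intro: eval_Succ)
  then have "recursive (Suc 0) (\<lambda>xs. Suc (hd xs))" by (auto simp: recursive_def)
  from recursive_comp1[OF this assms] show ?thesis by simp
qed

lemma recursive_const: "recursive n (\<lambda>_. c)"
proof (induction c)
  case 0
  show ?case by (auto simp: recursive_def intro: eval_Zero exI[of _ Zero])
qed (rule recursive_Suc)

text \<open>\<open>PrimRec\<close> recurses on its first argument, so the scheme is first obtained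
  with the counter in front; then \<open>k xs\<close> is substituted. The step sees the counter, the
  previous value and the parameters, in this order.\<close>

lemma recursive_rec:
  assumes "recursive n k" "recursive n b" "recursive (Suc (Suc n)) s"
  shows "recursive n (\<lambda>xs. rec_nat (b xs) (\<lambda>i r. s (i # r # xs)) (k xs))"
proof -
  obtain pb where pb: "\<And>xs. length xs = n \<Longrightarrow> eval {} pb xs (b xs)"
    using assms(2) by (auto simp: recursive_def)
  obtain ps where ps: "\<And>xs. length xs = Suc (Suc n) \<Longrightarrow> eval {} ps xs (s xs)"
    using assms(3) by (auto simp: recursive_def)
  have *: "eval {} (PrimRec pb ps) (j # xs) (rec_nat (b xs) (\<lambda>i r. s (i # r # xs)) j)"
    if "length xs = n" for xs j
  proof (induction j)
    case 0
    show ?case by (simp add: eval_PrimRec_0 pb that)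
  next
    case (Suc j)
    show ?case using eval_PrimRec_Suc[OF Suc ps] that by simp
  qed
  have "recursive (Suc n) (\<lambda>ys. rec_nat (b (tl ys)) (\<lambda>i r. s (i # r # tl ys)) (hd ys))"
    unfolding recursive_def by (rule exI[of _ "PrimRec pb ps"]) (auto simp: length_Suc_conv *)
  from recursive_comp[OF this recursive_list_Cons[OF assms(1) recursive_list_id]]
  show ?thesis by simp
qed

text \<open>A bound variable enters as a new first argument: it is \<open>hd ys\<close>, and the old
  parameters are \<open>tl ys\<close>.\<close>

lemma recursive_weaken_tl: "recursive n f \<Longrightarrow> recursive (Suc n) (\<lambda>ys. f (tl ys))"
  by (rule recursive_comp[OF _ recursive_list_tl])

lemma recursive_hd: "0 < n \<Longrightarrow> recursive n hd"
  by (rule recursive_cong[OF recursive_nth[of 0]]) (auto simp: hd_conv_nth)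

lemma recursive_nth_tl: "Suc i < n \<Longrightarrow> recursive n (\<lambda>ys. tl ys ! i)"
  by (rule recursive_cong[OF recursive_nth[of "Suc i"]]) (auto simp: nth_tl)

lemma recursive_add:
  assumes "recursive n f" "recursive n g"
  shows "recursive n (\<lambda>xs. f xs + g xs)"
proof -
  have eq: "rec_nat a (\<lambda>_ r. Suc r) k = k + a" for a k :: nat
    by (induction k) auto
  have "recursive (Suc (Suc n)) (\<lambda>ys. Suc (ys ! 1))"
    by (intro recursive_Suc recursive_nth) auto
  from recursive_rec[OF assms(1,2) this]
  show ?thesis by (simp add: eq[unfolded One_nat_def])
qed

lemma recursive_mult:
  assumes "recursive n f" "recursive n g"
  shows "recursive n (\<lambda>xs. f xs * g xs)"
proof -
  have eq: "rec_nat 0 (\<lambda>_ r. r + a) k = k * a" for a k :: nat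
    by (induction k) auto
  have "recursive (Suc (Suc n)) (\<lambda>ys. ys ! 1 + g (tl (tl ys)))"
    by (intro recursive_add recursive_nth recursive_weaken_tl assms) auto
  from recursive_rec[OF assms(1) recursive_const[of _ 0] this]
  show ?thesis by (simp add: eq[unfolded One_nat_def])
qed

lemma recursive_pred:
  assumes "recursive n f"
  shows "recursive n (\<lambda>xs. f xs - 1)"
proof -
  have "rec_nat 0 (\<lambda>i _. i) k = k - 1" for k :: nat
    by (induction k) auto
  then show ?thesis
    using recursive_rec[OF assms recursive_const[of _ 0] recursive_nth[of 0]] by simp
qed

lemma recursive_diff:
  assumes "recursive n f" "recursive n g"
  shows "recursive n (\<lambda>xs. f xs - g xs)"
proof -
  have eq: "rec_nat a (\<lambda>_ r. r - 1) k = a - k" for a k :: nat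
    by (induction k) auto
  have "recursive (Suc (Suc n)) (\<lambda>ys. ys ! 1 - 1)"
    by (intro recursive_pred recursive_nth) auto
  from recursive_rec[OF assms(2,1) this]
  show ?thesis by (simp add: eq[unfolded One_nat_def])
qed

lemma recursive_power:
  assumes "recursive n f"
  shows "recursive n (\<lambda>xs. 2 ^ f xs)"
proof -
  have eq: "rec_nat 1 (\<lambda>_ r. r * 2) k = (2::nat) ^ k" for k
    by (induction k) auto
  have "recursive (Suc (Suc n)) (\<lambda>ys. ys ! 1 * 2)"
    by (intro recursive_mult recursive_nth recursive_const) auto
  from recursive_rec[OF assms recursive_const[of _ 1] this]
  show ?thesis by (simp add: eq[unfolded One_nat_def])
qed

lemma recursive_sum:
  assumes "recursive n k" "recursive (Suc n) (\<lambda>ys. f (hd ys) (tl ys))"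
  shows "recursive n (\<lambda>xs. \<Sum>i<k xs. f i xs)"
proof -
  have eq: "rec_nat 0 (\<lambda>i r. r + h i) j = (\<Sum>i<j. h i)" for h :: "nat \<Rightarrow> nat" and j
    by (induction j) auto
  \<comment> \<open>The recursion step receives \<open>i # r # xs\<close>; the partial sum
    \<open>r\<close> is skipped to reach the parameters of \<open>f\<close>.\<close>
  have "recursive (Suc (Suc n)) (\<lambda>ys. f (hd ys) (tl (tl ys)))"
    using recursive_comp[OF assms(2) recursive_list_Cons[OF recursive_hd
      recursive_list_drop[of 2 n, simplified]]]
    by (simp add: drop_Suc numeral_2_eq_2)
  then have "recursive (Suc (Suc n)) (\<lambda>ys. ys ! 1 + f (hd ys) (tl (tl ys)))"
    by (intro recursive_add recursive_nth) auto
  from recursive_rec[OF assms(1) recursive_const[of _ 0] this]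
  show ?thesis by (simp add: eq[unfolded One_nat_def])
qed

text \<open>Predicates are represented by 0-1 values. Truncated subtraction makes
  \<open>f xs - g xs\<close> vanish exactly when \<open>f xs <= g xs\<close>.\<close>

lemma recursive_le:
  assumes "recursive n f" "recursive n g"
  shows "recursive n (\<lambda>xs. of_bool (f xs \<le> g xs))"
proof -
  have "recursive n (\<lambda>xs. 1 - (f xs - g xs))"
    by (intro recursive_diff recursive_const assms)
  then show ?thesis by (rule recursive_cong) (auto simp: not_le)
qed

lemma recursive_not:
  assumes "recursive n (\<lambda>xs. of_bool (P xs))"
  shows "recursive n (\<lambda>xs. of_bool (\<not> P xs))"
proof -
  have "recursive n (\<lambda>xs. 1 - of_bool (P xs))"
    by (intro recursive_diff recursive_const assms)
  then show ?thesis by (rule recursive_cong) auto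
qed

lemma recursive_conj:
  assumes "recursive n (\<lambda>xs. of_bool (P xs))" "recursive n (\<lambda>xs. of_bool (Q xs))"
  shows "recursive n (\<lambda>xs. of_bool (P xs \<and> Q xs))"
  using recursive_mult[OF assms] by (rule recursive_cong) auto

lemma recursive_less:
  "recursive n f \<Longrightarrow> recursive n g \<Longrightarrow> recursive n (\<lambda>xs. of_bool (f xs < g xs))"
  using recursive_not[OF recursive_le, of n g f] by (simp add: not_le)

lemma recursive_eq:
  assumes "recursive n f" "recursive n g"
  shows "recursive n (\<lambda>xs. of_bool (f xs = g xs))"
  using recursive_conj[OF recursive_le recursive_le, OF assms assms(2,1)]
  by (rule recursive_cong) auto

lemma recursive_if:
  assumes "recursive n (\<lambda>xs. of_bool (P xs))" "recursive n f" "recursive n g"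
  shows "recursive n (\<lambda>xs. if P xs then f xs else g xs)"
proof -
  have "recursive n (\<lambda>xs. of_bool (P xs) * f xs + of_bool (\<not> P xs) * g xs)"
    by (intro recursive_add recursive_mult recursive_not assms)
  then show ?thesis by (rule recursive_cong) auto
qed

lemma recursive_disj:
  assumes "recursive n (\<lambda>xs. of_bool (P xs))" "recursive n (\<lambda>xs. of_bool (Q xs))"
  shows "recursive n (\<lambda>xs. of_bool (P xs \<or> Q xs))"
  using recursive_not[OF recursive_conj[OF recursive_not recursive_not, OF assms]] by simp

lemma recursive_all_less:
  assumes "recursive n k" "recursive (Suc n) (\<lambda>ys. of_bool (P (hd ys) (tl ys)))"
  shows "recursive n (\<lambda>xs. of_bool (\<forall>i<k xs. P i xs))"
proof -
  have "recursive n (\<lambda>xs. of_bool ((\<Sum>i<k xs. of_bool (\<not> P i xs)) = (0::nat)))"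
    by (intro recursive_eq recursive_sum recursive_const recursive_not assms)
  then show ?thesis by (rule recursive_cong) auto
qed

text \<open>Unbounded search, total because a witness exists. \<open>Mu\<close> looks for a zero,
  hence the negated predicate in \<open>p\<close>.\<close>

lemma recursive_Least:
  assumes "recursive (Suc n) (\<lambda>ys. of_bool (P (hd ys) (tl ys)))"
    and ex: "\<And>xs. length xs = n \<Longrightarrow> \<exists>k. P k xs"
  shows "recursive n (\<lambda>xs. LEAST k. P k xs)"
proof -
  obtain p where p: "\<And>xs. length xs = Suc n \<Longrightarrow> eval {} p xs (of_bool (\<not> P (hd xs) (tl xs)))"
    using recursive_not[OF assms(1)] by (auto simp: recursive_def)
  have "eval {} (Mu p) xs (LEAST k. P k xs)" if "length xs = n" for xs
  proof (rule eval_Mu)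
    have "P (LEAST k. P k xs) xs" using ex[OF that] by (rule LeastI_ex)
    then show "eval {} p ((LEAST k. P k xs) # xs) 0"
      using p[of "(LEAST k. P k xs) # xs"] that by simp
    show "\<forall>m<(LEAST k. P k xs). \<exists>y. eval {} p (m # xs) (Suc y)"
    proof (intro allI impI)
      fix m assume "m < (LEAST k. P k xs)"
      then have "\<not> P m xs" by (rule not_less_Least)
      then show "\<exists>y. eval {} p (m # xs) (Suc y)"
        using p[of "m # xs"] that by (auto intro: exI[of _ 0])
    qed
  qed
  then show ?thesis by (auto simp: recursive_def)
qed

section \<open>Decoding pairs and lists\<close>

lemma recursive_triangle:
  assumes "recursive n f"
  shows "recursive n (\<lambda>xs. triangle (f xs))"
proof -
  have "triangle k = (\<Sum>i<k. Suc i)" for k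
    by (induction k) auto
  moreover have "recursive n (\<lambda>xs. \<Sum>i<f xs. Suc i)"
    by (intro recursive_sum recursive_Suc recursive_hd assms) simp
  ultimately show ?thesis by simp
qed

text \<open>The pairing function is \<open>triangle (m + n) + m\<close>. The antidiagonal
  \<open>m + n\<close> is the least \<open>w\<close> with \<open>c < triangle (Suc w)\<close>, and
  both components follow by subtraction.\<close>

lemma prod_decode_Least:
  "prod_decode c = (let w = LEAST w. c < triangle (Suc w) in (c - triangle w, w - (c - triangle w)))"
proof -
  obtain m n where mn: "prod_decode c = (m, n)" by fastforce
  then have c: "c = triangle (m + n) + m"
    using prod_decode_inverse[of c] by (simp add: prod_encode_def)
  have mono: "triangle i \<le> triangle j" if "i \<le> j" for i j
    using that by (rule lift_Suc_mono_le[rotated]) simp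
  have least: "(LEAST w. c < triangle (Suc w)) = m + n"
  proof (rule Least_equality)
    show "c < triangle (Suc (m + n))" by (simp add: c)
    show "m + n \<le> w" if "c < triangle (Suc w)" for w
    proof (rule ccontr)
      assume "\<not> m + n \<le> w"
      then have "triangle (Suc w) \<le> triangle (m + n)" by (intro mono) simp
      then show False using that c by linarith
    qed
  qed
  show ?thesis unfolding mn Let_def least using c by simp
qed

lemma recursive_prod_decode:
  assumes "recursive n f"
  shows recursive_fst: "recursive n (\<lambda>xs. fst (prod_decode (f xs)))"
    and recursive_snd: "recursive n (\<lambda>xs. snd (prod_decode (f xs)))"
proof -
  have "\<exists>w. c < triangle (Suc w)" for c
    by (rule exI[of _ c], induction c) auto
  then have "recursive n (\<lambda>xs. LEAST w. f xs < triangle (Suc w))"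
    by (intro recursive_Least recursive_less recursive_weaken_tl assms recursive_triangle
        recursive_Suc recursive_hd) simp_all
  then show "recursive n (\<lambda>xs. fst (prod_decode (f xs)))"
    "recursive n (\<lambda>xs. snd (prod_decode (f xs)))"
    unfolding prod_decode_Least Let_def fst_conv snd_conv
    by (intro recursive_diff recursive_triangle assms; assumption)+
qed

text \<open>A nonempty list is coded by the successor of the pair of its head and the code of its
  tail, and the empty list by 0. So \<open>?t\<close> computes the code of the tail, and dropping
  iterates \<open>?t\<close>.\<close>

lemma recursive_list_encode_drop:
  assumes "recursive n f" "recursive n k"
  shows "recursive n (\<lambda>xs. list_encode (drop (k xs) (list_decode (f xs))))"
proof -
  let ?t = "\<lambda>c. if c = 0 then 0 else snd (prod_decode (c - 1))"
  have tl: "list_encode (tl L) = ?t (list_encode L)" for L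
    by (cases L) auto
  have eq: "rec_nat c (\<lambda>_ r. ?t r) i = list_encode (drop i (list_decode c))" for c i
  proof (induction i)
    case (Suc i)
    then show ?case by (simp add: drop_Suc tl[symmetric] tl_drop del: list_encode_inverse)
  qed simp
  have "recursive (Suc (Suc n)) (\<lambda>ys. ?t (ys ! 1))"
    by (intro recursive_if recursive_eq recursive_nth recursive_const recursive_snd recursive_diff) auto
  from recursive_rec[OF assms(2,1) this] show ?thesis
    by (simp only: eq[unfolded One_nat_def] One_nat_def nth_Cons_Suc nth_Cons_0)
qed

lemma recursive_length:
  assumes "recursive n f"
  shows "recursive n (\<lambda>xs. length (list_decode (f xs)))"
proof -
  have z: "list_encode L = 0 \<longleftrightarrow> L = []" for L by (cases L) auto
  have "(LEAST i. list_encode (drop i L) = 0) = length L" for L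
    unfolding z by (rule Least_equality) auto
  moreover have "recursive n (\<lambda>xs. LEAST i. list_encode (drop i (list_decode (f xs))) = 0)"
    by (intro recursive_Least recursive_eq recursive_list_encode_drop recursive_const
        recursive_weaken_tl assms recursive_hd) (auto simp: z)
  ultimately show ?thesis by simp
qed

text \<open>Reads an entry from the code alone. Past the end the value is 0, because
  \<open>0 - 1 = 0\<close> and 0 codes the pair of zeros.\<close>

definition entry :: "nat \<Rightarrow> nat \<Rightarrow> nat" where
  "entry c i = fst (prod_decode (list_encode (drop i (list_decode c)) - 1))"

lemma entry_list_encode: "i < length L \<Longrightarrow> entry (list_encode L) i = L ! i"
  by (simp add: entry_def Cons_nth_drop_Suc[symmetric])

lemma recursive_entry:
  "recursive n f \<Longrightarrow> recursive n k \<Longrightarrow> recursive n (\<lambda>xs. entry (f xs) (k xs))"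
  unfolding entry_def
  by (intro recursive_fst recursive_diff recursive_const recursive_list_encode_drop)

lemmas recursive_intros =
  recursive_const recursive_nth recursive_hd recursive_nth_tl recursive_Suc recursive_add
  recursive_mult recursive_diff recursive_power recursive_le recursive_less recursive_eq
  recursive_not recursive_conj recursive_disj recursive_if recursive_fst recursive_snd
  recursive_length recursive_entry

section \<open>Computations with finite information\<close>

text \<open>The values of \<open>bounded_eval\<close> and of its oracle \<open>Q\<close> are shifted by one: \<open>0\<close> stands for
  divergence, and \<open>s\<close> bounds the unbounded searches.\<close>

fun bounded_eval :: "nat \<Rightarrow> (nat \<Rightarrow> nat) \<Rightarrow> functional \<Rightarrow> nat list \<Rightarrow> nat" where
  "bounded_eval s Q Zero xs = 1"
| "bounded_eval s Q Succ xs = (case xs of [x] \<Rightarrow> Suc (Suc x) | _ \<Rightarrow> 0)"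
| "bounded_eval s Q (Proj i) xs = (if i < length xs then Suc (xs ! i) else 0)"
| "bounded_eval s Q Query xs = (case xs of [x] \<Rightarrow> Q x | _ \<Rightarrow> 0)"
| "bounded_eval s Q (Comp f gs) xs =
    (if prod_list (map (\<lambda>g. bounded_eval s Q g xs) gs) = 0 then 0
     else bounded_eval s Q f (map (\<lambda>g. bounded_eval s Q g xs - 1) gs))"
| "bounded_eval s Q (PrimRec f g) xs =
    (case xs of [] \<Rightarrow> 0 | k # ys \<Rightarrow>
      rec_nat (bounded_eval s Q f ys)
        (\<lambda>i r. if r = 0 then 0 else bounded_eval s Q g (i # (r - 1) # ys)) k)"
| "bounded_eval s Q (Mu f) xs =
    (let k = LEAST k. s < k \<or> bounded_eval s Q f (k # xs) \<le> 1 in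
     if k \<le> s \<and> bounded_eval s Q f (k # xs) = 1 then Suc k else 0)"

text \<open>Serves composition: a product of shifted values is nonzero exactly when all the inner
  computations have a result.\<close>

lemma recursive_prod_list:
  "(\<And>g. g \<in> set gs \<Longrightarrow> recursive n (F g)) \<Longrightarrow> recursive n (\<lambda>xs. prod_list (map (\<lambda>g. F g xs) gs))"
  by (induction gs) (auto intro: recursive_const recursive_mult)

text \<open>Induction on the fixed program \<open>p\<close>, so programs are never coded. The list
  \<open>ys\<close> holds the search bound, a parameter selecting the oracle, and the arguments of
  \<open>p\<close>.\<close>

lemma recursive_bounded_eval:
  assumes Q: "recursive 2 (\<lambda>xs. Q (xs ! 0) (xs ! 1))"
  shows "recursive (Suc (Suc n)) (\<lambda>ys. bounded_eval (ys ! 0) (Q (ys ! 1)) p (drop 2 ys))"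
proof (induction p arbitrary: n)
  case Zero
  show ?case by (simp add: recursive_const)
next
  case Succ
  show ?case
  proof (cases "n = 1")
    case True
    have "recursive (Suc (Suc n)) (\<lambda>ys. Suc (Suc (ys ! 2)))"
      using True by (intro recursive_intros) auto
    then show ?thesis
      by (rule recursive_cong) (auto simp: True length_Suc_conv numeral_2_eq_2)
  next
    case False
    show ?thesis
      by (rule recursive_cong[OF recursive_const[of _ 0]])
        (use False in \<open>auto simp: length_Suc_conv numeral_2_eq_2 split: list.splits\<close>)
  qed
next
  case (Proj i)
  show ?case
  proof (cases "i < n")
    case True
    have "recursive (Suc (Suc n)) (\<lambda>ys. Suc (ys ! (2 + i)))"
      using True by (intro recursive_intros) auto
    then show ?thesis
      by (rule recursive_cong) (auto simp: True)
  next
    case False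
    show ?thesis
      by (rule recursive_cong[OF recursive_const[of _ 0]]) (use False in auto)
  qed
next
  case Query
  show ?case
  proof (cases "n = 1")
    case True
    have "recursive (Suc (Suc n)) (\<lambda>ys. Q (ys ! 1) (ys ! 2))"
      using recursive_comp2[OF Q[unfolded numeral_2_eq_2] recursive_nth[of 1 "Suc (Suc n)"]
        recursive_nth[of 2 "Suc (Suc n)"]] True by simp
    then show ?thesis
      by (rule recursive_cong) (auto simp: True length_Suc_conv numeral_2_eq_2)
  next
    case False
    show ?thesis
      by (rule recursive_cong[OF recursive_const[of _ 0]])
        (use False in \<open>auto simp: length_Suc_conv numeral_2_eq_2 split: list.splits\<close>)
  qed
next
  case (Comp f gs)
  let ?F = "\<lambda>g ys. bounded_eval (ys ! 0) (Q (ys ! 1)) g (drop 2 ys)"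
  have 1: "recursive (Suc (Suc n)) (\<lambda>ys. prod_list (map (\<lambda>g. ?F g ys) gs))"
    by (rule recursive_prod_list) (rule Comp.IH(2))
  have 2: "recursive_list (Suc (Suc n)) (length gs) (\<lambda>ys. map (\<lambda>g. ?F g ys - 1) gs)"
    by (rule recursive_list_map) (intro recursive_diff recursive_const Comp.IH(2))
  have "recursive (Suc (Suc n)) (\<lambda>ys. ?F f (ys ! 0 # ys ! 1 # map (\<lambda>g. ?F g ys - 1) gs))"
    by (rule recursive_comp[OF Comp.IH(1)[of "length gs"]], intro recursive_list_Cons 2 recursive_nth) simp_all
  then have 3: "recursive (Suc (Suc n))
      (\<lambda>ys. bounded_eval (ys ! 0) (Q (ys ! 1)) f (map (\<lambda>g. ?F g ys - 1) gs))"
    by (simp add: numeral_2_eq_2)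
  show ?case unfolding bounded_eval.simps
    by (intro recursive_if recursive_eq recursive_const 1 3)
next
  case (PrimRec f g)
  show ?case
  proof (cases n)
    case 0
    show ?thesis by (rule recursive_cong[OF recursive_const[of _ 0]]) (auto simp: 0)
  next
    case (Suc m)
    let ?F = "\<lambda>g ys. bounded_eval (ys ! 0) (Q (ys ! 1)) g (drop 2 ys)"
    have b: "recursive (Suc (Suc n)) (\<lambda>ys. ?F f (ys ! 0 # ys ! 1 # drop 3 ys))"
      by (rule recursive_comp[OF PrimRec.IH(1)[of m]],
          intro recursive_list_Cons recursive_nth)
        (use recursive_list_drop[of 3 m] Suc in \<open>auto simp: numeral_3_eq_3\<close>)
    \<comment> \<open>The list holds counter, shifted previous value, search bound, oracle
      parameter, recursion argument and then the other arguments, which start at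
      \<open>drop 5\<close>.\<close>
    have "recursive (Suc (Suc (Suc (Suc n))))
        (\<lambda>ys. ?F g (ys ! 2 # ys ! 3 # ys ! 0 # (ys ! 1 - 1) # drop 5 ys))"
      by (rule recursive_comp[OF PrimRec.IH(2)[of "Suc (Suc m)"]],
          intro recursive_list_Cons recursive_nth recursive_diff recursive_const)
        (use recursive_list_drop[of 5 m] Suc in \<open>auto simp: eval_nat_numeral\<close>)
    then have s: "recursive (Suc (Suc (Suc (Suc n)))) (\<lambda>ys. if ys ! 1 = 0 then 0
        else ?F g (ys ! 2 # ys ! 3 # ys ! 0 # (ys ! 1 - 1) # drop 5 ys))"
      by (intro recursive_if recursive_eq recursive_nth recursive_const) auto
    show ?thesis
      by (rule recursive_cong[OF recursive_rec[OF recursive_nth[of 2] b s]])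
        (auto simp: Suc length_Suc_conv eval_nat_numeral cong: if_cong)
  qed
next
  case (Mu f)
  let ?F = "\<lambda>ys. bounded_eval (ys ! 0) (Q (ys ! 1)) f (drop 2 ys)"
  have h: "recursive (Suc (Suc (Suc n))) (\<lambda>zs. ?F (tl zs ! 0 # tl zs ! 1 # hd zs # drop 3 zs))"
    by (rule recursive_comp[OF Mu.IH[of "Suc n"]],
        intro recursive_list_Cons recursive_hd recursive_nth_tl)
      (use recursive_list_drop[of 3 n] in \<open>auto simp: numeral_3_eq_3\<close>)
  then have G: "recursive (Suc (Suc (Suc n)))
      (\<lambda>zs. bounded_eval (tl zs ! 0) (Q (tl zs ! 1)) f (hd zs # drop 2 (tl zs)))"
    by (simp add: drop_Suc eval_nat_numeral)
  \<comment> \<open>The search is total since every \<open>k\<close> above the bound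
    \<open>ys ! 0\<close> satisfies the condition.\<close>
  have L: "recursive (Suc (Suc n))
      (\<lambda>ys. LEAST k. ys ! 0 < k \<or> bounded_eval (ys ! 0) (Q (ys ! 1)) f (k # drop 2 ys) \<le> 1)"
    by (intro recursive_Least recursive_intros G) auto
  have V: "recursive (Suc (Suc n)) (\<lambda>ys. bounded_eval (ys ! 0) (Q (ys ! 1)) f
      ((LEAST k. ys ! 0 < k \<or> bounded_eval (ys ! 0) (Q (ys ! 1)) f (k # drop 2 ys) \<le> 1) # drop 2 ys))"
    using recursive_comp[OF G recursive_list_Cons[OF L recursive_list_id]] by simp
  show ?case unfolding bounded_eval.simps Let_def
    by (intro recursive_intros L V) auto
qed

text \<open>Answers of \<open>Q\<close> are correct where defined, so a finite part of the oracle
  may be used; a computation that asks for more yields 0, that is, no value.\<close>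

lemma bounded_eval_sound:
  assumes Q: "\<And>q z. Q q = Suc z \<Longrightarrow> z = chi X q"
  shows "bounded_eval s Q p xs = Suc y \<Longrightarrow> eval X p xs y"
proof (induction p arbitrary: xs y)
  case Zero
  then show ?case by (simp add: eval_Zero)
next
  case Succ
  then show ?case by (auto split: list.splits intro: eval_Succ)
next
  case (Proj i)
  then show ?case by (auto split: if_splits intro: eval_Proj)
next
  case Query
  then show ?case by (auto split: list.splits dest!: Q intro: eval_Query)
next
  case (Comp f gs)
  let ?ys = "map (\<lambda>g. bounded_eval s Q g xs - 1) gs"
  from Comp.prems have nz: "0 \<notin> set (map (\<lambda>g. bounded_eval s Q g xs) gs)"
    and f: "bounded_eval s Q f ?ys = Suc y"
    by (auto split: if_splits simp: prod_list_zero_iff)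
  have "eval X (gs ! i) xs (?ys ! i)" if "i < length gs" for i
  proof -
    have "bounded_eval s Q (gs ! i) xs \<noteq> 0"
      using nz that by (metis length_map nth_map nth_mem)
    then show ?thesis using that Comp.IH(2)[of "gs ! i" xs] by simp
  qed
  with Comp.IH(1)[OF f] show ?case by (intro eval_Comp[where ys = ?ys]) auto
next
  case (PrimRec f g)
  then obtain k ys where xs: "xs = k # ys" by (auto split: list.splits)
  let ?r = "rec_nat (bounded_eval s Q f ys)
    (\<lambda>i r. if r = 0 then 0 else bounded_eval s Q g (i # (r - 1) # ys))"
  have "?r k = Suc y \<Longrightarrow> eval X (PrimRec f g) (k # ys) y"
  proof (induction k arbitrary: y)
    case 0
    then show ?case by (auto intro: eval_PrimRec_0 PrimRec.IH(1))
  next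
    case (Suc k)
    then obtain r where "?r k = Suc r" "bounded_eval s Q g (k # r # ys) = Suc y"
      by (cases "?r k") auto
    then show ?case by (auto intro: eval_PrimRec_Suc Suc.IH PrimRec.IH(2))
  qed
  with PrimRec.prems xs show ?case by simp
next
  case (Mu f)
  let ?P = "\<lambda>k. s < k \<or> bounded_eval s Q f (k # xs) \<le> 1"
  from Mu.prems have y: "y = (LEAST k. ?P k)" "bounded_eval s Q f (y # xs) = Suc 0"
    by (auto simp: Let_def split: if_splits)
  have "\<exists>z. eval X f (m # xs) (Suc z)" if "m < y" for m
  proof -
    \<comment> \<open>Before \<open>y\<close> the search condition fails, so the shifted value is at
      least 2: the computation halts with a nonzero value.\<close>
    have "1 < bounded_eval s Q f (m # xs)"
      using not_less_Least[of m ?P] that y(1) by auto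
    then have "bounded_eval s Q f (m # xs) = Suc (Suc (bounded_eval s Q f (m # xs) - 2))" by simp
    then show ?thesis by (blast intro: Mu.IH)
  qed
  with Mu.IH[OF y(2)] show ?case by (auto intro: eval_Mu)
qed

text \<open>A halting computation makes finitely many queries and searches, and one \<open>m\<close>
  bounds both. Quantifying over all \<open>s\<close> from \<open>m\<close> on and all
  \<open>Q\<close> correct below \<open>m\<close> lets the bounds of finitely many subcomputations
  be combined.\<close>

lemma bounded_eval_complete:
  "eval X p xs y \<Longrightarrow> \<forall>\<^sub>F m in sequentially. \<forall>s Q. m \<le> s \<longrightarrow>
    (\<forall>q<m. Q q = Suc (chi X q)) \<longrightarrow> bounded_eval s Q p xs = Suc y"
proof (induction rule: eval.induct)
  case (eval_Query x)
  show ?case using eventually_gt_at_top[of x] by eventually_elim auto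
next
  case (eval_Comp ys gs xs f z)
  have "\<forall>\<^sub>F m in sequentially. \<forall>i\<in>{..<length gs}. \<forall>s Q. m \<le> s \<longrightarrow>
    (\<forall>q<m. Q q = Suc (chi X q)) \<longrightarrow> bounded_eval s Q (gs ! i) xs = Suc (ys ! i)"
    using eval_Comp.IH(1) by (intro eventually_ball_finite) auto
  with eval_Comp.IH(2) show ?case
  proof eventually_elim
    case (elim m)
    show ?case
    proof (intro allI impI)
      fix s Q assume sQ: "m \<le> s" "\<forall>q<m. Q q = Suc (chi X q)"
      have g: "bounded_eval s Q (gs ! i) xs = Suc (ys ! i)" if "i < length gs" for i
        using elim sQ that by blast
      have "map (\<lambda>g. bounded_eval s Q g xs - 1) gs = ys"
        by (rule nth_equalityI) (auto simp: g eval_Comp.hyps)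
      moreover have "0 \<notin> set (map (\<lambda>g. bounded_eval s Q g xs) gs)"
        by (auto simp: in_set_conv_nth g)
      ultimately show "bounded_eval s Q (Comp f gs) xs = Suc z"
        using elim sQ by (auto simp: prod_list_zero_iff)
    qed
  qed
next
  case (eval_PrimRec_Suc f g k xs r z)
  from eval_PrimRec_Suc.IH show ?case by eventually_elim auto
next
  case (eval_Mu f k xs)
  have "\<forall>\<^sub>F m in sequentially. \<forall>j\<in>{..<k}. \<exists>y. \<forall>s Q. m \<le> s \<longrightarrow>
    (\<forall>q<m. Q q = Suc (chi X q)) \<longrightarrow> bounded_eval s Q f (j # xs) = Suc (Suc y)"
  proof (intro eventually_ball_finite ballI)
    fix j assume "j \<in> {..<k}"
    then obtain y where "\<forall>\<^sub>F m in sequentially. \<forall>s Q. m \<le> s \<longrightarrow>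
      (\<forall>q<m. Q q = Suc (chi X q)) \<longrightarrow> bounded_eval s Q f (j # xs) = Suc (Suc y)"
      using eval_Mu.IH(2) by blast
    then show "\<forall>\<^sub>F m in sequentially. \<exists>y. \<forall>s Q. m \<le> s \<longrightarrow>
      (\<forall>q<m. Q q = Suc (chi X q)) \<longrightarrow> bounded_eval s Q f (j # xs) = Suc (Suc y)"
      by eventually_elim blast
  qed simp
  with eval_Mu.IH(1) eventually_ge_at_top[of k] show ?case
  proof eventually_elim
    case (elim m)
    show ?case
    proof (intro allI impI)
      fix s Q assume sQ: "m \<le> s" "\<forall>q<m. Q q = Suc (chi X q)"
      have k: "bounded_eval s Q f (k # xs) = Suc 0" using elim sQ by blast
      have "(LEAST k. s < k \<or> bounded_eval s Q f (k # xs) \<le> 1) = k"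
      proof (rule Least_equality)
        fix j assume j: "s < j \<or> bounded_eval s Q f (j # xs) \<le> 1"
        show "k \<le> j"
        proof (rule ccontr)
          assume "\<not> k \<le> j"
          then have "j < k" by simp
          moreover from this obtain y where "bounded_eval s Q f (j # xs) = Suc (Suc y)"
            using elim sQ by blast
          ultimately show False using j elim sQ by simp
        qed
      qed (simp add: k)
      then show "bounded_eval s Q (Mu f) xs = Suc k" using k elim sQ by (simp add: Let_def)
    qed
  qed
qed auto

section \<open>Computably enumerable sets and codes of strings\<close>

lemma ce_ex:
  assumes "recursive 2 (\<lambda>xs. of_bool (P (xs ! 0) (xs ! 1)))"
  shows "ce {x. \<exists>z. P z x}"
proof -
  obtain p where p: "\<And>xs. length xs = 2 \<Longrightarrow> eval {} p xs (of_bool (\<not> P (xs ! 0) (xs ! 1)))"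
    using recursive_not[OF assms] by (auto simp: recursive_def)
  have "x \<in> dom (run (Mu p) {}) \<longleftrightarrow> (\<exists>z. P z x)" for x
  proof
    assume "x \<in> dom (run (Mu p) {})"
    then obtain z where "eval {} (Mu p) [x] z" by (auto simp: run_eq_Some_iff)
    then have "eval {} p [z, x] 0" by (auto elim: eval.cases)
    from eval_deterministic[OF this p[of "[z, x]"]] show "\<exists>z. P z x" by auto
  next
    assume ex: "\<exists>z. P z x"
    have "eval {} (Mu p) [x] (LEAST z. P z x)"
    proof (intro eval_Mu allI impI)
      show "eval {} p [LEAST z. P z x, x] 0"
        using p[of "[LEAST z. P z x, x]"] LeastI_ex[OF ex] by simp
      show "\<exists>y. eval {} p [m, x] (Suc y)" if "m < (LEAST z. P z x)" for m
        using p[of "[m, x]"] not_less_Least[OF that] by (auto intro: exI[of _ 0])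
    qed
    then show "x \<in> dom (run (Mu p) {})" by (auto simp: dom_def run_eq_Some_iff)
  qed
  then show ?thesis unfolding ce_def by blast
qed

lemma computableI: "recursive 1 (\<lambda>xs. chi B (xs ! 0)) \<Longrightarrow> computable B"
  unfolding recursive_def computable_def run_eq_Some_iff
  by (metis One_nat_def length_Cons list.size(3) nth_Cons_0)

lemma recursive_chi:
  assumes "computable Z" "recursive n f"
  shows "recursive n (\<lambda>xs. chi Z (f xs))"
proof -
  obtain p where "\<And>n. eval {} p [n] (chi Z n)"
    using assms(1) by (auto simp: computable_def run_eq_Some_iff)
  then have "recursive 1 (\<lambda>xs. chi Z (xs ! 0))"
    by (auto simp: recursive_def length_Suc_conv intro!: exI[of _ p])
  from recursive_comp1[OF this[unfolded One_nat_def] assms(2)] show ?thesis by simp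
qed

lemma length_string_code [simp]: "length (list_decode (string_code s)) = length s"
  by (simp add: string_code_def)

lemma entry_string_code [simp]: "i < length s \<Longrightarrow> entry (string_code s) i = of_bool (s ! i)"
  by (simp add: string_code_def entry_list_encode)

definition is_string :: "nat \<Rightarrow> bool" where
  "is_string x \<longleftrightarrow> (\<forall>i<length (list_decode x). entry x i \<le> 1)"

lemma recursive_is_string:
  "recursive n f \<Longrightarrow> recursive n (\<lambda>xs. of_bool (is_string (f xs)))"
  unfolding is_string_def
  by (intro recursive_all_less recursive_intros recursive_weaken_tl) auto

lemma is_string_iff: "is_string x \<longleftrightarrow> x \<in> range string_code"
proof
  assume x: "is_string x"
  define L where "L = list_decode x"
  have xL: "x = list_encode L" by (simp add: L_def)
  have "map of_bool (map (\<lambda>y. y = 1) L) = L"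
  proof (rule nth_equalityI)
    fix i assume "i < length (map of_bool (map (\<lambda>y. y = 1) L) :: nat list)"
    then have "i < length L" "L ! i \<le> 1"
      using x by (auto simp: is_string_def xL entry_list_encode)
    then show "map of_bool (map (\<lambda>y. y = 1) L) ! i = L ! i" by auto
  qed simp
  then have "x = string_code (map (\<lambda>y. y = 1) L)" by (simp add: string_code_def xL)
  then show "x \<in> range string_code" by blast
qed (auto simp: is_string_def)

text \<open>\<open>Sigma01\<close> speaks of the exact set of codes, so the search for a witness is
  combined with the decidable test \<open>is_string\<close>.\<close>

lemma Sigma01_ex:
  assumes "recursive 2 (\<lambda>xs. of_bool (P (xs ! 0) (xs ! 1)))"
  shows "Sigma01 {s. \<exists>z. P z (string_code s)}"
proof -
  have "ce {x. \<exists>z. is_string x \<and> P z x}"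
    by (rule ce_ex) (intro recursive_conj recursive_is_string recursive_nth assms; simp)
  moreover have "{x. \<exists>z. is_string x \<and> P z x} = string_code ` {s. \<exists>z. P z (string_code s)}"
    by (auto simp: is_string_iff)
  ultimately show ?thesis by (simp add: Sigma01_def)
qed

section \<open>Forcing\<close>

definition graft :: "bool list \<Rightarrow> nat set \<Rightarrow> nat set" where
  "graft t A = {i. if i < length t then t ! i else i \<in> A}"

lemma length_initial_segment [simp]: "length (initial_segment A n) = n"
  by (simp add: initial_segment_def)

lemma nth_initial_segment [simp]: "i < n \<Longrightarrow> initial_segment A n ! i = (i \<in> A)"
  by (simp add: initial_segment_def)

lemma prefix_initial_segment_graft:
  "length t \<le> n \<Longrightarrow> prefix t (initial_segment (graft t A) n)"
  by (auto simp: prefix_def graft_def intro!: exI[of _ "drop (length t) (initial_segment (graft t A) n)"]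
      nth_equalityI simp: nth_append)

lemma initial_segment_graft: "initial_segment (graft t A) (length t) = t"
  by (rule nth_equalityI) (auto simp: graft_def)

text \<open>If the conflicting strings were dense, \<open>A\<close> would meet them. Hence all information enumerated
  above some string \<open>s0\<close> is consistent, and it is correct because every \<open>t\<close> extending \<open>s0\<close> can be
  continued by \<open>A\<close>.\<close>

lemma computable_if_enumerated:
  assumes gen: "weakly_1_generic A"
    and g: "recursive 2 (\<lambda>xs. g (xs ! 0) (xs ! 1))"
    and col: "recursive 1 (\<lambda>xs. col (xs ! 0))"
    and sound: "\<And>X z m v. g z (string_code (initial_segment X m)) = Suc v \<Longrightarrow> G X z v"
    and complete: "\<And>X z v. G X z v \<Longrightarrow>
      \<forall>\<^sub>F m in sequentially. g z (string_code (initial_segment X m)) = Suc v"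
    and correct: "\<And>z v. G A z v \<Longrightarrow> v = chi B (col z)"
    and total: "\<And>t n. \<exists>z. col z = n \<and> G (graft t A) z (chi B n)"
  shows "computable B"
proof -
  have g': "recursive n (\<lambda>xs. g (f xs) (h xs))" if "recursive n f" "recursive n h" for n f h
    using recursive_comp2[OF g[unfolded numeral_2_eq_2] that] by simp
  have col': "recursive n (\<lambda>xs. col (f xs))" if "recursive n f" for n f
    using recursive_comp1[OF col[unfolded One_nat_def] that] by simp
  \<comment> \<open>\<open>g z x = Suc v\<close> means that the string coded by \<open>x\<close>
    shows the value \<open>v\<close> for the bit \<open>col z\<close>; \<open>G X z v\<close> is the
    same claim about all of \<open>X\<close>. A conflict is a pair of indices giving one bit
    different values.\<close>
  define P where "P z x \<longleftrightarrow> col (fst (prod_decode z)) = col (snd (prod_decode z)) \<and>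
    0 < g (fst (prod_decode z)) x \<and> 0 < g (snd (prod_decode z)) x \<and>
    \<not> g (fst (prod_decode z)) x = g (snd (prod_decode z)) x" for z x
  let ?S = "{s. \<exists>z. P z (string_code s)}"
  have P_I: "s \<in> ?S" if "col z = col z'" "g z (string_code s) = Suc v" "g z' (string_code s) = Suc v'"
    "v \<noteq> v'" for s z z' v v'
    using that by (auto simp: P_def intro!: exI[of _ "prod_encode (z, z')"])
  have "recursive 2 (\<lambda>xs. of_bool (P (xs ! 0) (xs ! 1)))"
    unfolding P_def by (intro recursive_intros g' col') auto
  then have "Sigma01 ?S" by (rule Sigma01_ex)
  \<comment> \<open>By \<open>sound\<close>, a conflict on an initial segment of \<open>A\<close>
    would give two claims true of \<open>A\<close> with different values, against
    \<open>correct\<close>.\<close>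
  moreover have "initial_segment A n \<notin> ?S" for n
  proof
    assume "initial_segment A n \<in> ?S"
    then obtain z where z: "P z (string_code (initial_segment A n))" by blast
    then have "\<exists>v v'. G A (fst (prod_decode z)) v \<and> G A (snd (prod_decode z)) v' \<and> v \<noteq> v' \<and>
        col (fst (prod_decode z)) = col (snd (prod_decode z))"
      unfolding P_def by (metis sound gr0_conv_Suc)
    then show False using correct by metis
  qed
  ultimately have "\<not> dense_strings ?S" using gen unfolding weakly_1_generic_def by blast
  then obtain s0 where s0: "\<And>t. prefix s0 t \<Longrightarrow> t \<notin> ?S" unfolding dense_strings_def by blast
  \<comment> \<open>A wrong value on \<open>t\<close> persists along the continuation of
    \<open>t\<close> by \<open>A\<close>, where by \<open>total\<close> the right value appears too.
    So a long initial segment is a conflict above \<open>s0\<close>.\<close>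
  have key: "v = chi B (col z)" if "prefix s0 t" "g z (string_code t) = Suc v" for t z v
  proof (rule ccontr)
    assume ne: "v \<noteq> chi B (col z)"
    let ?X = "graft t A"
    have 1: "G ?X z v" using sound[of z ?X "length t"] that by (simp add: initial_segment_graft)
    obtain z' where z': "col z' = col z" "G ?X z' (chi B (col z))" using total by blast
    from complete[OF 1] complete[OF z'(2)] eventually_ge_at_top[of "length t"]
    have "\<forall>\<^sub>F m in sequentially. g z (string_code (initial_segment ?X m)) = Suc v \<and>
      g z' (string_code (initial_segment ?X m)) = Suc (chi B (col z)) \<and> length t \<le> m"
      by eventually_elim simp
    then obtain m where m: "g z (string_code (initial_segment ?X m)) = Suc v"
      "g z' (string_code (initial_segment ?X m)) = Suc (chi B (col z))" "length t \<le> m"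
      using eventually_happens'[OF sequentially_bot] by blast
    have "prefix s0 (initial_segment ?X m)"
      using that(1) prefix_initial_segment_graft[OF m(3)] by (rule prefix_order.trans)
    with s0 P_I[OF z'(1)[symmetric] m(1,2) ne] show False by blast
  qed
  \<comment> \<open>\<open>w\<close> pairs the code of an extension of \<open>s0\<close> with an
    index for the bit \<open>n\<close> whose value that string shows. Searching for \<open>w\<close>
    decides the bit.\<close>
  define R where "R w n \<longleftrightarrow> is_string (fst (prod_decode w)) \<and>
    length s0 \<le> length (list_decode (fst (prod_decode w))) \<and>
    (\<forall>i<length s0. entry (fst (prod_decode w)) i = entry (string_code s0) i) \<and>
    col (snd (prod_decode w)) = n \<and> 0 < g (snd (prod_decode w)) (fst (prod_decode w))" for w n
  have R_ex: "\<exists>w. R w n" for n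
  proof -
    let ?X = "graft s0 A"
    obtain z where z: "col z = n" "G ?X z (chi B n)" using total by blast
    from complete[OF z(2)] eventually_ge_at_top[of "length s0"]
    have "\<forall>\<^sub>F m in sequentially. g z (string_code (initial_segment ?X m)) = Suc (chi B n) \<and>
      length s0 \<le> m" by eventually_elim simp
    then obtain m where m: "g z (string_code (initial_segment ?X m)) = Suc (chi B n)" "length s0 \<le> m"
      using eventually_happens'[OF sequentially_bot] by blast
    then show ?thesis using z(1)
      by (intro exI[of _ "prod_encode (string_code (initial_segment ?X m), z)"])
        (auto simp: R_def is_string_iff graft_def)
  qed
  have R_val: "g (snd (prod_decode w)) (fst (prod_decode w)) - 1 = chi B n" if "R w n" for w n
  proof -
    obtain t where t: "fst (prod_decode w) = string_code t"
      using \<open>R w n\<close> by (auto simp: R_def is_string_iff)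
    have "t = s0 @ drop (length s0) t"
      by (rule nth_equalityI) (use \<open>R w n\<close> t in \<open>auto simp: R_def nth_append of_bool_eq_iff\<close>)
    then have "prefix s0 t" by (metis prefixI)
    moreover obtain v where "g (snd (prod_decode w)) (string_code t) = Suc v"
      using \<open>R w n\<close> t by (auto simp: R_def gr0_conv_Suc)
    ultimately show ?thesis using key[of t "snd (prod_decode w)" v] \<open>R w n\<close> t by (simp add: R_def)
  qed
  have "recursive (Suc 1) (\<lambda>ys. of_bool (R (hd ys) (tl ys ! 0)))"
    unfolding R_def
    by (intro recursive_conj recursive_is_string recursive_all_less recursive_intros g' col'
        recursive_weaken_tl) auto
  then have "recursive 1 (\<lambda>xs. LEAST w. R w (xs ! 0))"
    by (rule recursive_Least) (rule R_ex)
  then have "recursive 1 (\<lambda>xs. g (snd (prod_decode (LEAST w. R w (xs ! 0))))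
      (fst (prod_decode (LEAST w. R w (xs ! 0)))) - 1)"
    by (intro recursive_intros g')
  then have "recursive 1 (\<lambda>xs. chi B (xs ! 0))"
    by (rule recursive_cong) (rule R_val, rule LeastI_ex, rule R_ex)
  then show ?thesis by (rule computableI)
qed

section \<open>Reductions to a weakly 1-generic real\<close>

text \<open>The block of \<open>k\<close> is the interval of \<open>w k\<close> places from
  \<open>l k\<close> on. With \<open>w k = 1\<close>, a majority is membership of the place
  \<open>l k\<close>.\<close>

definition majority :: "(nat \<Rightarrow> nat) \<Rightarrow> (nat \<Rightarrow> nat) \<Rightarrow> nat \<Rightarrow> nat set \<Rightarrow> bool" where
  "majority l w k Y \<longleftrightarrow> w k < 2 * card {i. i < w k \<and> l k + i \<in> Y}"

lemma majority_mono:
  "majority l w k Y \<Longrightarrow> (\<And>i. i < w k \<Longrightarrow> l k + i \<in> Y \<Longrightarrow> l k + i \<in> Z) \<Longrightarrow> majority l w k Z"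
  unfolding majority_def
  by (erule order.strict_trans2) (auto intro!: card_mono)

text \<open>Two disjoint parts of a block, each more than half of it, would exceed its size.\<close>

lemma majority_Int:
  assumes "majority l w k Y" "majority l w k Z"
  shows "\<exists>i<w k. l k + i \<in> Y \<inter> Z"
proof (rule ccontr)
  assume "\<not> ?thesis"
  then have "{i. i < w k \<and> l k + i \<in> Y} \<inter> {i. i < w k \<and> l k + i \<in> Z} = {}" by auto
  then have "card {i. i < w k \<and> l k + i \<in> Y} + card {i. i < w k \<and> l k + i \<in> Z}
      = card ({i. i < w k \<and> l k + i \<in> Y} \<union> {i. i < w k \<and> l k + i \<in> Z})"
    by (simp add: card_Un_disjoint)
  also have "\<dots> \<le> card {..<w k}" by (rule card_mono) auto
  finally show False using assms by (simp add: majority_def)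
qed

text \<open>\<open>V a X\<close> is the oracle formed from \<open>X\<close> with parameter
  \<open>a\<close>, and \<open>Q\<close> answers its queries as far as a string permits. The
  information enumerated is that some value has a majority on the block of a place coding
  \<open>n\<close>, not before the cut-off \<open>N\<close>.\<close>

lemma computable_if_majority:
  fixes V :: "nat \<Rightarrow> nat set \<Rightarrow> nat set"
  assumes gen: "weakly_1_generic A"
    and Q: "recursive 2 (\<lambda>xs. Q (xs ! 0) (xs ! 1))"
    and l: "recursive 1 (\<lambda>xs. l (xs ! 0))" and w: "recursive 1 (\<lambda>xs. w (xs ! 0))"
    and QO: "\<And>a X m q. Q (prod_encode (a, string_code (initial_segment X m))) q =
      (if q < m then Suc (chi (V a X) q) else 0)"
    and correct: "\<And>a m n v. N \<le> (2 * m + 1) * 2 ^ n \<Longrightarrow>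
      majority l w ((2 * m + 1) * 2 ^ n) {x. run p (V a A) x = Some v} \<Longrightarrow> v = chi B n"
    and total: "\<And>t n. \<exists>a m. N \<le> (2 * m + 1) * 2 ^ n \<and>
      majority l w ((2 * m + 1) * 2 ^ n) {x. run p (V a (graft t A)) x = Some (chi B n)}"
  shows "computable B"
proof -
  \<comment> \<open>An index \<open>z\<close> claims that the oracle with parameter \<open>par z\<close> yields a majority for \<open>val z\<close> on the
    block of \<open>pos z\<close>; the constant \<open>triangle (par z + x) + par z\<close> in \<open>ev\<close> is \<open>prod_encode (par z, x)\<close>.\<close>
  define val where "val z = fst (prod_decode z)" for z
  define par where "par z = fst (prod_decode (snd (prod_decode z)))" for z
  define row where "row z = fst (prod_decode (snd (prod_decode (snd (prod_decode z)))))" for z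
  define col where "col z = snd (prod_decode (snd (prod_decode (snd (prod_decode z)))))" for z
  define pos where "pos z = (2 * row z + 1) * 2 ^ col z" for z
  define ev where "ev z x i = bounded_eval (length (list_decode x))
    (Q (triangle (par z + x) + par z)) p [l (pos z) + i]" for z x i
  \<comment> \<open>\<open>g\<close> counts the places where the string suffices to obtain
    \<open>val z\<close>, with its length as search bound; \<open>G\<close> is the claim for the
    full oracle.\<close>
  define g where "g z x = (if N \<le> pos z \<and> w (pos z) < 2 * (\<Sum>i<w (pos z). of_bool (ev z x i = Suc (val z)))
    then Suc (val z) else 0)" for z x
  define G where "G X z v \<longleftrightarrow> N \<le> pos z \<and> v = val z \<and>
    majority l w (pos z) {x. run p (V (par z) X) x = Some v}" for X z v
  have l': "recursive n (\<lambda>xs. l (f xs))" if "recursive n f" for n f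
    using recursive_comp1[OF l[unfolded One_nat_def] that] by simp
  have w': "recursive n (\<lambda>xs. w (f xs))" if "recursive n f" for n f
    using recursive_comp1[OF w[unfolded One_nat_def] that] by simp
  have evd: "recursive n (\<lambda>xs. bounded_eval (s xs) (Q (c xs)) p [x xs])"
    if "recursive n s" "recursive n c" "recursive n x" for n s c x
  proof -
    have "recursive_list n (Suc (Suc (Suc 0))) (\<lambda>xs. [s xs, c xs, x xs])"
      by (intro recursive_list_Cons recursive_list_Nil that)
    from recursive_comp[OF recursive_bounded_eval[OF Q, of 1 p, unfolded One_nat_def] this]
    show ?thesis by simp
  qed
  have pos': "recursive n (\<lambda>xs. pos (f xs))" if "recursive n f" for n f
    unfolding pos_def row_def col_def by (intro recursive_intros that)
  have sum_eq: "(\<Sum>i<k. of_bool (R i)) = card {i. i < k \<and> R i}" for k and R :: "nat \<Rightarrow> bool"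
    by (simp add: Collect_conj_eq lessThan_def)
  show ?thesis
  proof (rule computable_if_enumerated[OF gen, of g col G])
    show "recursive 1 (\<lambda>xs. col (xs ! 0))"
      unfolding col_def by (intro recursive_intros) auto
    show "recursive 2 (\<lambda>xs. g (xs ! 0) (xs ! 1))"
      unfolding g_def ev_def val_def par_def
      by (intro recursive_if recursive_conj recursive_less recursive_mult recursive_sum
          recursive_intros evd l' w' pos' recursive_triangle) auto
  next
    fix X z m v
    let ?x = "string_code (initial_segment X m)"
    assume gz: "g z ?x = Suc v"
    then have v: "v = val z" "N \<le> pos z" by (auto simp: g_def split: if_splits)
    have "run p (V (par z) X) (l (pos z) + i) = Some v" if "ev z ?x i = Suc v" for i
      unfolding run_eq_Some_iff
      by (rule bounded_eval_sound[OF _ that[unfolded ev_def]])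
        (use QO[of "par z" X m] in \<open>auto simp: prod_encode_def split: if_splits\<close>)
    then have "card {i. i < w (pos z) \<and> ev z ?x i = Suc v} \<le>
      card {i. i < w (pos z) \<and> l (pos z) + i \<in> {x. run p (V (par z) X) x = Some v}}"
      by (intro card_mono) auto
    then show "G X z v" using gz v
      by (auto simp: G_def g_def majority_def sum_eq split: if_splits)
  next
    fix X z v
    assume G: "G X z v"
    let ?I = "{i. i < w (pos z) \<and> l (pos z) + i \<in> {x. run p (V (par z) X) x = Some v}}"
    \<comment> \<open>The block is finite, so one \<open>m\<close> makes all its computations with
      value \<open>v\<close> visible.\<close>
    have "\<forall>\<^sub>F m in sequentially. \<forall>i\<in>?I. ev z (string_code (initial_segment X m)) i = Suc v"
    proof (rule eventually_ball_finite, simp, intro ballI)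
      fix i assume "i \<in> ?I"
      then have "eval (V (par z) X) p [l (pos z) + i] v" by (simp add: run_eq_Some_iff)
      from bounded_eval_complete[OF this]
      show "\<forall>\<^sub>F m in sequentially. ev z (string_code (initial_segment X m)) i = Suc v"
      proof eventually_elim
        case (elim m)
        then show ?case using QO[of "par z" X m] by (auto simp: ev_def prod_encode_def)
      qed
    qed
    then show "\<forall>\<^sub>F m in sequentially. g z (string_code (initial_segment X m)) = Suc v"
    proof eventually_elim
      case (elim m)
      let ?x = "string_code (initial_segment X m)"
      have "card ?I \<le> card {i. i < w (pos z) \<and> ev z ?x i = Suc v}"
        using elim by (intro card_mono) auto
      then show ?case using G by (auto simp: G_def g_def majority_def sum_eq)
    qed
  next
    show "v = chi B (col z)" if "G A z v" for z v
      using that correct unfolding G_def pos_def by blast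
    show "\<exists>z. col z = n \<and> G (graft t A) z (chi B n)" for t n
    proof -
      obtain a m where "N \<le> (2 * m + 1) * 2 ^ n"
        "majority l w ((2 * m + 1) * 2 ^ n) {x. run p (V a (graft t A)) x = Some (chi B n)}"
        using total by blast
      then show ?thesis
        by (intro exI[of _ "prod_encode (chi B n, prod_encode (a, prod_encode (m, n)))"])
          (simp add: G_def pos_def row_def col_def par_def val_def)
    qed
  qed
qed

text \<open>Any string can be extended past a block in the domain with every bit of the block chosen
  against the computation: by \<open>ge\<close> a late block lies beyond the string, so its bits are
  still free. Genericity then yields such a block for \<open>A\<close>.\<close>

lemma disagrees_on_block:
  assumes gen: "weakly_1_generic A" and Z: "computable Z"
    and l: "recursive 1 (\<lambda>xs. l (xs ! 0))" and w: "recursive 1 (\<lambda>xs. w (xs ! 0))"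
    and ge: "\<And>k. k \<le> l k"
    and dom: "\<And>N. \<exists>k\<ge>N. \<forall>i<w k. l k + i \<in> dom (run p Z)"
  shows "\<exists>k\<ge>N. \<forall>i<w k. run p Z (l k + i) \<notin> {None, Some (chi A (l k + i))}"
proof -
  have l': "recursive n (\<lambda>xs. l (f xs))" if "recursive n f" for n f
    using recursive_comp1[OF l[unfolded One_nat_def] that] by simp
  have w': "recursive n (\<lambda>xs. w (f xs))" if "recursive n f" for n f
    using recursive_comp1[OF w[unfolded One_nat_def] that] by simp
  define Q where "Q c q = Suc (chi Z q)" for c q :: nat
  have Q: "recursive 2 (\<lambda>xs. Q (xs ! 0) (xs ! 1))"
    unfolding Q_def by (intro recursive_intros recursive_chi[OF Z]) auto
  have evd: "recursive n (\<lambda>xs. bounded_eval (s xs) (Q 0) p [x xs])"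
    if "recursive n s" "recursive n x" for n s x
  proof -
    have "recursive_list n (Suc (Suc (Suc 0))) (\<lambda>xs. [s xs, 0, x xs])"
      by (intro recursive_list_Cons recursive_list_Nil recursive_const that)
    from recursive_comp[OF recursive_bounded_eval[OF Q, of 1 p, unfolded One_nat_def] this]
    show ?thesis by simp
  qed
  define ev where "ev s x = bounded_eval s (Q 0) p [x]" for s x
  \<comment> \<open>\<open>z\<close> pairs a block with a search bound. The string must reach past
    the block, as \<open>entry\<close> would otherwise return the default 0.\<close>
  define P where "P z x \<longleftrightarrow> N \<le> fst (prod_decode z) \<and>
    l (fst (prod_decode z)) + w (fst (prod_decode z)) \<le> length (list_decode x) \<and>
    (\<forall>i<w (fst (prod_decode z)). \<not> ev (snd (prod_decode z)) (l (fst (prod_decode z)) + i) = 0 \<and>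
      \<not> ev (snd (prod_decode z)) (l (fst (prod_decode z)) + i) = Suc (entry x (l (fst (prod_decode z)) + i)))"
    for z x
  let ?S = "{s. \<exists>z. P z (string_code s)}"
  have "recursive 2 (\<lambda>xs. of_bool (P (xs ! 0) (xs ! 1)))"
    unfolding P_def ev_def
    by (intro recursive_conj recursive_all_less recursive_intros l' w' evd) auto
  then have "Sigma01 ?S" by (rule Sigma01_ex)
  moreover have "dense_strings ?S"
    unfolding dense_strings_def
  proof
    fix s :: "bool list"
    obtain k where k: "max N (length s) \<le> k" "\<And>i. i < w k \<Longrightarrow> l k + i \<in> dom (run p Z)"
      using dom by blast
    \<comment> \<open>Beyond \<open>s\<close> the bit is 0 exactly where the output is 1, so on the
      block it differs from every output, also from those above 1.\<close>
    define t where "t = initial_segment (graft s {x. run p Z x \<noteq> Some 1}) (l k + w k)"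
    have "length s \<le> l k + w k" using k(1) ge[of k] by linarith
    then have "prefix s t" unfolding t_def by (rule prefix_initial_segment_graft)
    have "\<forall>\<^sub>F st in sequentially. \<forall>i\<in>{..<w k}. run p Z (l k + i) = Some (ev st (l k + i) - 1) \<and>
      ev st (l k + i) \<noteq> 0"
    proof (rule eventually_ball_finite, simp, intro ballI)
      fix i assume "i \<in> {..<w k}"
      then obtain v where v: "run p Z (l k + i) = Some v" using k(2) by blast
      then have "eval Z p [l k + i] v" by (simp add: run_eq_Some_iff)
      from bounded_eval_complete[OF this]
      show "\<forall>\<^sub>F st in sequentially. run p Z (l k + i) = Some (ev st (l k + i) - 1) \<and>
          ev st (l k + i) \<noteq> 0"
        by eventually_elim (auto simp: v ev_def Q_def)
    qed
    then obtain st where st: "\<And>i. i < w k \<Longrightarrow> run p Z (l k + i) = Some (ev st (l k + i) - 1) \<and>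
      ev st (l k + i) \<noteq> 0"
      using eventually_happens'[OF sequentially_bot] by blast
    have "entry (string_code t) (l k + i) = of_bool (run p Z (l k + i) \<noteq> Some 1)" if "i < w k" for i
      using that k(1) ge[of k] by (simp add: t_def graft_def)
    then have "P (prod_encode (k, st)) (string_code t)"
      using k(1) st by (fastforce simp: P_def t_def)
    with \<open>prefix s t\<close> show "\<exists>t\<in>?S. prefix s t" by blast
  qed
  ultimately obtain n z where "P z (string_code (initial_segment A n))"
    using gen unfolding weakly_1_generic_def by blast
  then have "\<exists>k st. N \<le> k \<and> l k + w k \<le> n \<and> (\<forall>i<w k. ev st (l k + i) \<noteq> 0 \<and>
      ev st (l k + i) \<noteq> Suc (chi A (l k + i)))"
    unfolding P_def
    by (intro exI[of _ "fst (prod_decode z)"] exI[of _ "snd (prod_decode z)"])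
      (auto simp: chi_def)
  then obtain k st where k: "N \<le> k" "\<And>i. i < w k \<Longrightarrow> ev st (l k + i) \<noteq> 0 \<and>
      ev st (l k + i) \<noteq> Suc (chi A (l k + i))" by blast
  have "run p Z (l k + i) \<notin> {None, Some (chi A (l k + i))}" if "i < w k" for i
  proof -
    have "ev st (l k + i) = Suc (ev st (l k + i) - 1)" using k(2)[OF that] by simp
    then have "run p Z (l k + i) = Some (ev st (l k + i) - 1)"
      unfolding run_eq_Some_iff ev_def by (rule bounded_eval_sound[rotated]) (simp add: Q_def)
    then show ?thesis using k(2)[OF that] by auto
  qed
  with k(1) show ?thesis by blast
qed

section \<open>The two codings and majorities on their blocks\<close>

lemma chi_cal_R: "chi (cal_R B) ((2 * m + 1) * 2 ^ n) = chi B n"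
proof -
  \<comment> \<open>Parity tells whether an exponent is 0; otherwise a factor 2 is cancelled on both
    sides.\<close>
  have "n' = n" if "(2 * m + 1) * 2 ^ n = (2 * m' + 1) * 2 ^ n'" for m m' n n' :: nat
    using that
  proof (induction n arbitrary: n')
    case 0
    have "odd ((2 * m + 1) * 2 ^ 0)" by simp
    then show ?case unfolding 0 by (cases n') auto
  next
    case (Suc n)
    have "even ((2 * m + 1) * 2 ^ Suc n)" by simp
    then obtain j where j: "n' = Suc j" unfolding Suc.prems by (cases n') auto
    then have "(2 * m + 1) * 2 ^ n = (2 * m' + 1) * 2 ^ j" using Suc.prems by simp
    with Suc.IH j show ?case by simp
  qed
  then have "(2 * m + 1) * 2 ^ n \<in> cal_R B \<longleftrightarrow> n \<in> B"
    unfolding cal_R_def by blast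
  then show ?thesis by (simp add: chi_def)
qed

lemma chi_cal_R_tilde: "i < 2 ^ k \<Longrightarrow> chi (cal_R_tilde X) (2 ^ k + i) = chi X k"
proof -
  assume i: "i < 2 ^ k"
  have "n = k" if "2 ^ n \<le> 2 ^ k + i" "2 ^ k + i < 2 ^ (n + 1)" for n
  proof (rule antisym)
    have "(2::nat) ^ n < 2 ^ (k + 1)" using that(1) i by simp
    then show "n \<le> k" by (metis less_Suc_eq_le nat_power_less_imp_less pos2 Suc_eq_plus1)
    have "(2::nat) ^ k < 2 ^ (n + 1)" using that(2) by simp
    then show "k \<le> n" by (metis less_Suc_eq_le nat_power_less_imp_less pos2 Suc_eq_plus1)
  qed
  with i have "2 ^ k + i \<in> cal_R_tilde X \<longleftrightarrow> k \<in> X"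
    by (auto simp: cal_R_tilde_def intro!: bexI[of _ k])
  then show ?thesis by (simp add: chi_def)
qed

lemma density_1_if_cofinite:
  assumes "finite (- Y)"
  shows "density_1 Y"
  unfolding density_1_def
proof (rule tendsto_sandwich)
  show "(\<lambda>n. 1 - real (card (- Y)) / real n) \<longlonglongrightarrow> 1"
    using tendsto_diff[OF tendsto_const lim_const_over_n, of 1 "real (card (- Y))"] by simp
  have "1 - real (card (- Y)) / real n \<le> real (card (Y \<inter> {..<n})) / real n" if "0 < n" for n
  proof -
    have "n = card {..<n}" by simp
    also have "\<dots> \<le> card ((Y \<inter> {..<n}) \<union> - Y)"
      using assms by (intro card_mono) auto
    also have "\<dots> \<le> card (Y \<inter> {..<n}) + card (- Y)" by (rule card_Un_le)
    finally have "real n - real (card (- Y)) \<le> real (card (Y \<inter> {..<n}))" by linarith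
    then have "(real n - real (card (- Y))) / real n \<le> real (card (Y \<inter> {..<n})) / real n"
      by (rule divide_right_mono) simp
    then show ?thesis using that by (simp add: diff_divide_distrib)
  qed
  then show "\<forall>\<^sub>F n in sequentially. 1 - real (card (- Y)) / real n \<le> real (card (Y \<inter> {..<n})) / real n"
    by (auto intro: eventually_mono[OF eventually_gt_at_top[of 0]])
  have "real (card (Y \<inter> {..<n})) / real n \<le> 1" for n
    using card_mono[of "{..<n}" "Y \<inter> {..<n}"] by (simp add: divide_le_eq)
  then show "\<forall>\<^sub>F n in sequentially. real (card (Y \<inter> {..<n})) / real n \<le> 1" by simp
qed simp

text \<open>Density above 3/4 below \<open>2 ^ (k + 1)\<close> gives more than
  \<open>3 / 2 * 2 ^ k\<close> elements there. At most \<open>2 ^ k\<close> of them lie below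
  \<open>2 ^ k\<close>, which leaves more than half of the block.\<close>

lemma majority_if_density_1:
  assumes "density_1 Y"
  shows "\<forall>\<^sub>F k in sequentially. majority (\<lambda>k. 2 ^ k) (\<lambda>k. 2 ^ k) k Y"
proof -
  have "\<forall>\<^sub>F n in sequentially. 3 / 4 < real (card (Y \<inter> {..<n})) / real n"
    using assms unfolding density_1_def by (rule order_tendstoD) simp
  then obtain N where N: "\<And>n. N \<le> n \<Longrightarrow> 3 / 4 < real (card (Y \<inter> {..<n})) / real n"
    unfolding eventually_sequentially by blast
  have "majority (\<lambda>k. 2 ^ k) (\<lambda>k. 2 ^ k) k Y" if "N \<le> k" for k
  proof -
    let ?I = "{i. i < 2 ^ k \<and> 2 ^ k + i \<in> Y}"
    have "Y \<inter> {..<2 ^ (k + 1)} \<subseteq> {..<2 ^ k} \<union> (+) (2 ^ k) ` ?I"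
    proof
      fix x assume x: "x \<in> Y \<inter> {..<2 ^ (k + 1)}"
      show "x \<in> {..<2 ^ k} \<union> (+) (2 ^ k) ` ?I"
      proof (cases "x < 2 ^ k")
        case False
        with x have "x = 2 ^ k + (x - 2 ^ k)" "x - 2 ^ k \<in> ?I" by auto
        then show ?thesis by blast
      qed simp
    qed
    then have "card (Y \<inter> {..<2 ^ (k + 1)}) \<le> card ({..<2 ^ k} \<union> (+) (2 ^ k) ` ?I)"
      by (intro card_mono) auto
    also have "\<dots> \<le> 2 ^ k + card ?I"
      by (rule order.trans[OF card_Un_le]) (simp add: card_image_le)
    finally have "real (card (Y \<inter> {..<2 ^ (k + 1)})) \<le> real (2 ^ k + card ?I)"
      by (rule of_nat_mono)
    moreover have "k < 2 ^ (k + 1)"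
      by (rule less_trans[OF less_exp]) simp
    then have "3 / 4 * 2 ^ (k + 1) < real (card (Y \<inter> {..<2 ^ (k + 1)}))"
      using N[of "2 ^ (k + 1)"] that by (simp add: field_simps)
    ultimately have "real (2 ^ k) < real (2 * card ?I)" by simp
    then show ?thesis unfolding majority_def of_nat_less_iff .
  qed
  then show ?thesis unfolding eventually_sequentially by blast
qed

lemma majority_if_cofinite:
  assumes "finite (- Y)"
  shows "\<forall>\<^sub>F k in sequentially. majority (\<lambda>k. k) (\<lambda>_. 1) k Y"
proof -
  have "\<forall>\<^sub>F k in sequentially. k \<in> Y"
    using assms by (simp flip: cofinite_eq_sequentially add: eventually_cofinite Compl_eq)
  then show ?thesis
  proof eventually_elim
    case (elim k)
    then have "{i. i < 1 \<and> k + i \<in> Y} = {0}" by auto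
    then show ?case by (simp add: majority_def)
  qed
qed

section \<open>Finite variants and partial oracles\<close>

lemma finite_graft: "finite {n. chi A n \<noteq> chi (graft t A) n}"
  by (rule finite_subset[of _ "{..<length t}"]) (auto simp: graft_def chi_def not_less)

lemma code_triples_iff:
  "q \<in> code_triples P \<longleftrightarrow> (fst (prod_decode q), fst (prod_decode (snd (prod_decode q))),
    snd (prod_decode (snd (prod_decode q)))) \<in> P"
proof
  assume "(fst (prod_decode q), fst (prod_decode (snd (prod_decode q))),
    snd (prod_decode (snd (prod_decode q)))) \<in> P"
  then show "q \<in> code_triples P"
    unfolding code_triples_def by (rule rev_image_eqI) simp
qed (auto simp: code_triples_def)

text \<open>Deleting the first \<open>a\<close> places of the oracle undoes a modification of \<open>A\<close> below \<open>a\<close>, so a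
  finite variant of \<open>A\<close> still yields legitimate partial oracles for \<open>A\<close> itself.\<close>

definition tail_oracle :: "nat \<Rightarrow> nat set \<Rightarrow> triples" where
  "tail_oracle a X = {(n, x, l). a \<le> n \<and> x = chi X n \<and> l = 0}"

lemma partial_oracle_tail_oracle: "partial_oracle A (tail_oracle a A)"
  by (auto simp: partial_oracle_def tail_oracle_def Uniq_def)

lemma finite_Compl_oracle_dom: "finite (- oracle_dom (tail_oracle a X))"
  by (rule finite_subset[of _ "{..<a}"]) (auto simp: oracle_dom_def tail_oracle_def not_less)

lemma tail_oracle_graft: "tail_oracle (length t) (graft t A) = tail_oracle (length t) A"
  by (auto simp: tail_oracle_def graft_def chi_def)

section \<open>Reducibilities over a notion of largeness\<close>

definition total_reducible :: "(nat set \<Rightarrow> bool) \<Rightarrow> nat set \<Rightarrow> nat set \<Rightarrow> bool" where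
  "total_reducible large B A \<longleftrightarrow> (\<exists>p. \<forall>C. large {n. chi A n = chi C n} \<longrightarrow>
    (\<exists>D. (\<forall>n. run p C n = Some (chi D n)) \<and> large {n. chi D n = chi B n}))"

definition partial_reducible :: "(nat set \<Rightarrow> bool) \<Rightarrow> nat set \<Rightarrow> nat set \<Rightarrow> bool" where
  "partial_reducible large B A \<longleftrightarrow> (\<exists>p. \<forall>P. partial_oracle A P \<and> large (oracle_dom P) \<longrightarrow>
    partial_computation B (run p (code_triples P)) \<and> large (dom (run p (code_triples P))))"

text \<open>Treats the four reducibilities together: \<open>large\<close> is density 1 for the
  generic and coarse ones, with dyadic intervals as blocks, and cofiniteness for the other two, with
  single places as blocks.\<close>

locale block_reduction =
  fixes large :: "nat set \<Rightarrow> bool" and l w :: "nat \<Rightarrow> nat"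
  assumes l: "recursive 1 (\<lambda>xs. l (xs ! 0))" and w: "recursive 1 (\<lambda>xs. w (xs ! 0))"
    and ge: "k \<le> l k"
    and large_majority: "large Y \<Longrightarrow> \<forall>\<^sub>F k in sequentially. majority l w k Y"
    and large_cofinite: "finite (- Y) \<Longrightarrow> large Y"
begin

lemma large_refl: "large {n. chi A n = chi A n}"
  by (rule large_cofinite) simp

lemma large_majority_ge: "large Y \<Longrightarrow> \<exists>N. \<forall>k\<ge>N. majority l w k Y"
  using large_majority unfolding eventually_sequentially by blast

text \<open>Beyond a fixed \<open>N\<close> the set computed from \<open>A\<close> agrees with
  \<open>T\<close> on most of each block, so a majority value is correct there. For the continuation
  of \<open>t\<close> this holds beyond some \<open>N'\<close> depending on \<open>t\<close>; a
  large odd factor moves the place coding \<open>n\<close> beyond both.\<close>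

lemma computable_if_total_reducible:
  assumes gen: "weakly_1_generic A"
    and T: "\<And>k i. i < w k \<Longrightarrow> chi T (l k + i) = chi (cal_R B) k"
    and red: "total_reducible large T A"
  shows "computable B"
proof -
  obtain p where p: "\<And>C. large {n. chi A n = chi C n} \<Longrightarrow>
      \<exists>D. (\<forall>n. run p C n = Some (chi D n)) \<and> large {n. chi D n = chi T n}"
    using red unfolding total_reducible_def by blast
  have large_graft: "large {n. chi A n = chi (graft t A) n}" for t
    using finite_graft[of A t] by (intro large_cofinite) (simp add: Compl_eq)
  obtain D where D: "\<And>n. run p A n = Some (chi D n)" "large {n. chi D n = chi T n}"
    using p[OF large_refl[of A]] by blast
  obtain N where N: "\<And>k. N \<le> k \<Longrightarrow> majority l w k {n. chi D n = chi T n}"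
    using large_majority_ge[OF D(2)] by blast
  define Q where "Q c q = (if q < length (list_decode (snd (prod_decode c)))
    then Suc (entry (snd (prod_decode c)) q) else 0)" for c q
  show ?thesis
  proof (rule computable_if_majority[OF gen _ l w, of Q "\<lambda>_ X. X" N p])
    show "recursive 2 (\<lambda>xs. Q (xs ! 0) (xs ! 1))"
      unfolding Q_def by (intro recursive_intros) auto
    show "Q (prod_encode (a, string_code (initial_segment X m))) q =
      (if q < m then Suc (chi X q) else 0)" for a X m q
      by (simp add: Q_def chi_def)
  next
    fix m n v :: nat
    define k where "k = (2 * m + 1) * 2 ^ n"
    assume "N \<le> (2 * m + 1) * 2 ^ n" "majority l w ((2 * m + 1) * 2 ^ n) {x. run p A x = Some v}"
    then have "N \<le> k" "majority l w k {x. run p A x = Some v}" by (simp_all only: k_def)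
    with majority_Int N obtain i where i: "i < w k" "chi D (l k + i) = chi T (l k + i)"
      "run p A (l k + i) = Some v" by blast
    then have "v = chi (cal_R B) k" using D(1) T[OF i(1)] by simp
    then show "v = chi B n" unfolding k_def chi_cal_R .
  next
    fix t n
    obtain D' where D': "\<And>n. run p (graft t A) n = Some (chi D' n)"
      "large {n. chi D' n = chi T n}"
      using p[OF large_graft] by blast
    obtain N' where N': "\<And>k. N' \<le> k \<Longrightarrow> majority l w k {n. chi D' n = chi T n}"
      using large_majority_ge[OF D'(2)] by blast
    define m where "m = max N N'"
    define k where "k = (2 * m + 1) * 2 ^ n"
    have "m \<le> (2 * m + 1) * 1" by simp
    also have "\<dots> \<le> k" unfolding k_def by (rule mult_le_mono2) simp
    finally have k: "N \<le> k" "N' \<le> k" by (auto simp: m_def)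
    have "chi (cal_R B) k = chi B n" unfolding k_def by (rule chi_cal_R)
    with D'(1) T have "majority l w k {x. run p (graft t A) x = Some (chi B n)}"
      by (intro majority_mono[OF N'[OF k(2)]]) auto
    with k(1) show "\<exists>a m. N \<le> (2 * m + 1) * 2 ^ n \<and>
      majority l w ((2 * m + 1) * 2 ^ n) {x. run p (graft t A) x = Some (chi B n)}"
      unfolding k_def by blast
  qed
qed

text \<open>A partial computation makes no errors, so the cut-off is 0. For the continuation of
  \<open>t\<close>, the parameter \<open>length t\<close> removes the changed places and leaves a
  partial oracle for \<open>A\<close>.\<close>

lemma computable_if_partial_reducible:
  assumes gen: "weakly_1_generic A"
    and T: "\<And>k i. i < w k \<Longrightarrow> chi T (l k + i) = chi (cal_R B) k"
    and red: "partial_reducible large T A"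
  shows "computable B"
proof -
  obtain p where p: "\<And>P. partial_oracle A P \<Longrightarrow> large (oracle_dom P) \<Longrightarrow>
      partial_computation T (run p (code_triples P)) \<and> large (dom (run p (code_triples P)))"
    using red unfolding partial_reducible_def by blast
  let ?V = "\<lambda>a X. code_triples (tail_oracle a X)"
  have p': "partial_computation T (run p (?V a A))" "large (dom (run p (?V a A)))" for a
    using p[OF partial_oracle_tail_oracle large_cofinite[OF finite_Compl_oracle_dom]] by blast+
  \<comment> \<open>\<open>q\<close> codes a triple, tested against the definition of
    \<open>tail_oracle\<close>. By \<open>fst_le\<close> its place is at most \<open>q\<close>, so
    the string has the required bit whenever \<open>q\<close> is below its length.\<close>
  define Q where "Q c q = (if q < length (list_decode (snd (prod_decode c)))
    then Suc (of_bool (fst (prod_decode c) \<le> fst (prod_decode q) \<and>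
      fst (prod_decode (snd (prod_decode q))) = entry (snd (prod_decode c)) (fst (prod_decode q)) \<and>
      snd (prod_decode (snd (prod_decode q))) = 0)) else 0)" for c q
  have fst_le: "fst (prod_decode q) \<le> q" for q
    using le_prod_encode_1[of "fst (prod_decode q)" "snd (prod_decode q)"] by simp
  show ?thesis
  proof (rule computable_if_majority[OF gen _ l w, of Q ?V 0 p])
    show "recursive 2 (\<lambda>xs. Q (xs ! 0) (xs ! 1))"
      unfolding Q_def by (intro recursive_intros) auto
    show "Q (prod_encode (a, string_code (initial_segment X m))) q =
      (if q < m then Suc (chi (?V a X) q) else 0)" for a X m q
      using fst_le[of q]
      by (auto simp: Q_def chi_def code_triples_iff tail_oracle_def)
  next
    fix a m n v :: nat
    define k where "k = (2 * m + 1) * 2 ^ n"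
    assume "majority l w ((2 * m + 1) * 2 ^ n) {x. run p (?V a A) x = Some v}"
    then have "majority l w k {x. run p (?V a A) x = Some v}" by (simp only: k_def)
    with majority_Int obtain i where i: "i < w k" "run p (?V a A) (l k + i) = Some v" by blast
    then have "v = chi (cal_R B) k"
      using p'(1)[of a] T[OF i(1)] unfolding partial_computation_def by (metis domI option.inject)
    then show "v = chi B n" unfolding k_def chi_cal_R .
  next
    fix t :: "bool list" and n
    let ?a = "length t"
    obtain N where N: "\<And>k. N \<le> k \<Longrightarrow> majority l w k (dom (run p (?V ?a A)))"
      using large_majority_ge[OF p'(2)] by blast
    define k where "k = (2 * N + 1) * 2 ^ n"
    have "N \<le> (2 * N + 1) * 1" by simp
    also have "\<dots> \<le> k" unfolding k_def by (rule mult_le_mono2) simp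
    finally have "N \<le> k" .
    have k: "chi (cal_R B) k = chi B n" unfolding k_def by (rule chi_cal_R)
    have "run p (?V ?a A) (l k + i) = Some (chi B n)"
      if "i < w k" "l k + i \<in> dom (run p (?V ?a A))" for i
      using p'(1)[of ?a] T[OF that(1)] that(2) k unfolding partial_computation_def by metis
    then have "majority l w k {x. run p (?V ?a (graft t A)) x = Some (chi B n)}"
      unfolding tail_oracle_graft by (intro majority_mono[OF N[OF \<open>N \<le> k\<close>]]) auto
    then show "\<exists>a m. 0 \<le> (2 * m + 1) * 2 ^ n \<and>
      majority l w ((2 * m + 1) * 2 ^ n) {x. run p (?V a (graft t A)) x = Some (chi B n)}"
      unfolding k_def by blast
  qed
qed

text \<open>The computed set agrees with \<open>A\<close> on most of every late block, but
  genericity makes them disagree on a whole one.\<close>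

lemma not_total_reducible:
  assumes gen: "weakly_1_generic A" and Z: "computable Z"
  shows "\<not> total_reducible large A Z"
proof
  assume red: "total_reducible large A Z"
  obtain p where p: "\<And>C. large {n. chi Z n = chi C n} \<Longrightarrow>
      \<exists>D. (\<forall>n. run p C n = Some (chi D n)) \<and> large {n. chi D n = chi A n}"
    using red unfolding total_reducible_def by blast
  obtain D where D: "\<And>n. run p Z n = Some (chi D n)" "large {n. chi D n = chi A n}"
    using p[OF large_refl[of Z]] by blast
  obtain N where N: "\<And>k. N \<le> k \<Longrightarrow> majority l w k {n. chi D n = chi A n}"
    using large_majority_ge[OF D(2)] by blast
  have "\<exists>k\<ge>N. \<forall>i<w k. run p Z (l k + i) \<notin> {None, Some (chi A (l k + i))}"
    by (rule disagrees_on_block[OF gen Z l w ge]) (auto simp: D(1))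
  then obtain k where "N \<le> k" "\<And>i. i < w k \<Longrightarrow> chi D (l k + i) \<noteq> chi A (l k + i)"
    by (auto simp: D(1))
  then show False using majority_Int[OF N N] by blast
qed

text \<open>A large domain need not contain a whole block, so \<open>disagrees_on_block\<close> is
  applied to single places. One wrong value already refutes a partial computation.\<close>

lemma not_partial_reducible:
  assumes gen: "weakly_1_generic A" and Z: "computable Z"
  shows "\<not> partial_reducible large A Z"
proof
  assume red: "partial_reducible large A Z"
  obtain p where p: "\<And>P. partial_oracle Z P \<Longrightarrow> large (oracle_dom P) \<Longrightarrow>
      partial_computation A (run p (code_triples P)) \<and> large (dom (run p (code_triples P)))"
    using red unfolding partial_reducible_def by blast
  let ?Z = "code_triples (tail_oracle 0 Z)"
  have p': "partial_computation A (run p ?Z)" "large (dom (run p ?Z))"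
    using p[OF partial_oracle_tail_oracle large_cofinite[OF finite_Compl_oracle_dom]] by blast+
  obtain N where N: "\<And>k. N \<le> k \<Longrightarrow> majority l w k (dom (run p ?Z))"
    using large_majority_ge[OF p'(2)] by blast
  have dom: "\<exists>k\<ge>M. k \<in> dom (run p ?Z)" for M
  proof -
    obtain i where "l (max M N) + i \<in> dom (run p ?Z)"
      using majority_Int[OF N[of "max M N"] N[of "max M N"]] by auto
    moreover have "M \<le> l (max M N) + i" using ge[of "max M N"] by linarith
    ultimately show ?thesis by blast
  qed
  \<comment> \<open>Membership in the coded oracle is decidable, so the functional runs with a
    computable oracle.\<close>
  have "recursive 1 (\<lambda>xs. of_bool (fst (prod_decode (snd (prod_decode (xs ! 0)))) =
      chi Z (fst (prod_decode (xs ! 0))) \<and> snd (prod_decode (snd (prod_decode (xs ! 0)))) = 0))"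
    by (intro recursive_intros recursive_chi[OF Z]) auto
  then have "recursive 1 (\<lambda>xs. chi ?Z (xs ! 0))"
    by (rule recursive_cong) (auto simp: chi_def code_triples_iff tail_oracle_def)
  then have "computable ?Z" by (rule computableI)
  moreover have "recursive 1 (\<lambda>xs. xs ! 0)" "recursive 1 (\<lambda>xs. 1)"
    by (intro recursive_intros; simp)+
  ultimately have "\<exists>k\<ge>0. \<forall>i<1. run p ?Z (k + i) \<notin> {None, Some (chi A (k + i))}"
    using dom by (intro disagrees_on_block[OF gen, where l = "\<lambda>k. k" and w = "\<lambda>_. 1"]) auto
  then show False using p'(1) by (auto simp: partial_computation_def)
qed

end

interpretation cofinite: block_reduction "\<lambda>Y. finite (- Y)" "\<lambda>k. k" "\<lambda>_. 1"
proof (rule block_reduction.intro)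
  show "recursive 1 (\<lambda>xs. xs ! 0)" by (rule recursive_nth) simp
  show "recursive 1 (\<lambda>xs. 1)" by (rule recursive_const)
  show "k \<le> k" for k :: nat by (rule order_refl)
qed (assumption | rule majority_if_cofinite)+

interpretation density: block_reduction density_1 "\<lambda>k. 2 ^ k" "\<lambda>k. 2 ^ k"
proof (rule block_reduction.intro)
  have "recursive 1 (\<lambda>xs. 2 ^ (xs ! 0))" by (rule recursive_power, rule recursive_nth) simp
  then show "recursive 1 (\<lambda>xs. 2 ^ (xs ! 0))" .
  then show "recursive 1 (\<lambda>xs. 2 ^ (xs ! 0))" .
  show "k \<le> 2 ^ k" for k :: nat by (rule less_imp_le[OF less_exp])
qed (erule majority_if_density_1 density_1_if_cofinite)+

theorem proposition5p3:
  fixes A :: "nat set"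
  assumes "weakly_1_generic A"
  shows "quasiminimal_cofinite A \<and> quasiminimal_mod_finite A \<and>
    quasiminimal_generic A \<and> quasiminimal_coarse A"
proof -
  have "(\<le>\<^sub>c\<^sub>f) = partial_reducible (\<lambda>Y. finite (- Y))" "(\<le>\<^sub>g) = partial_reducible density_1"
    "(\<le>\<^sub>m\<^sub>f) = total_reducible (\<lambda>Y. finite (- Y))" "(\<le>\<^sub>c) = total_reducible density_1"
    by (intro ext; simp add: cofinite_reducible_def cofinite_oracle_def generic_reducible_def
        generic_oracle_def mod_finite_reducible_def coarse_reducible_def partial_reducible_def
        total_reducible_def Compl_eq)+
  \<comment> \<open>With blocks of one place, \<open>cal_R B\<close> is itself the block
    coding.\<close>
  moreover have "quasiminimal (partial_reducible (\<lambda>Y. finite (- Y))) cal_R A"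
    using cofinite.not_partial_reducible[OF assms]
      cofinite.computable_if_partial_reducible[OF assms, where T = "cal_R B" and B = B for B]
    unfolding quasiminimal_def by auto
  moreover have "quasiminimal (total_reducible (\<lambda>Y. finite (- Y))) cal_R A"
    using cofinite.not_total_reducible[OF assms]
      cofinite.computable_if_total_reducible[OF assms, where T = "cal_R B" and B = B for B]
    unfolding quasiminimal_def by auto
  moreover have "quasiminimal (partial_reducible density_1) (\<lambda>B. cal_R_tilde (cal_R B)) A"
    using density.not_partial_reducible[OF assms]
      density.computable_if_partial_reducible[OF assms chi_cal_R_tilde]
    unfolding quasiminimal_def by blast
  moreover have "quasiminimal (total_reducible density_1) (\<lambda>B. cal_R_tilde (cal_R B)) A"
    using density.not_total_reducible[OF assms]
      density.computable_if_total_reducible[OF assms chi_cal_R_tilde]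
    unfolding quasiminimal_def by blast
  ultimately show ?thesis
    unfolding quasiminimal_cofinite_def quasiminimal_mod_finite_def quasiminimal_generic_def
      quasiminimal_coarse_def by simp
qed

end
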